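(* Let $\mathbb{F}$ be a field of characteristic $2$. Let $V$ be a finite-dimensional vector space over $\mathbb{F}$ and $b$ a non-degenerate symmetric bilinear form on $V$, with attached quadratic form $Q : x \mapsto b(x,x)$. Let $\nu$ be the Witt index of $b$ and $n := \dim V$. (a) The greatest dimension of a nilpotent linear subspace of $\mathcal{S}_b$ is $\nu(n-\nu)$. (b) If $n \neq 2\nu+1$, the greatest dimension of a nilpotent linear subspace of $\mathcal{A}_b$ is $\nu(n-\nu-1)$. (c) If $n = 2\nu+1$, the greatest dimension of a nilpotent linear subspace of $\mathcal{A}_b$ is $\nu(n-\nu) - \dim \operatorname{SKer} Q$.
   Context: An endomorphism $u$ of $V$ is $b$-symmetric (resp. $b$-alternating) if the bilinear form $(x,y)\mapsto b(x,u(y))$ is symmetric (resp. alternating, i.e. vanishes on all pairs $(x,x)$). $\mathcal{S}_b$ (resp. $\mathcal{A}_b$) denotes the linear subspace of $\operatorname{End}(V)$ consisting of $b$-symmetric (resp. $b$-alternating) endomorphisms. A linear subspace is nilpotent if all its elements are nilpotent. A subspace $X$ is totally $b$-singular if $b(x,y)=0$ for all $x,y\in X$; the Witt index $\nu(b)$ is the greatest dimension of a totally $b$-singular subspace. In characteristic $2$, $Q$ is additive and $\operatorname{Ker} Q = \{x \in V : Q(x)=0\}$ is a linear subspace; $\operatorname{SKer} Q := \operatorname{Ker} Q \cap (\operatorname{Ker} Q)^{\perp}$, where $X^\perp = \{y \in V : b(x,y)=0 \ \forall x\in X\}$. *)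

theory Defs
  imports Complex_Main "HOL-Library.Function_Algebras"
begin

text \<open>Abstract setting: a vector space V (a type 'v) over a field 'a, given by a
scalar multiplication scale. Endomorphisms of V are the linear maps 'v \<Rightarrow> 'v,
and End(V) carries the pointwise vector space structure end_scale.\<close>

definition end_scale :: "('a \<Rightarrow> 'v \<Rightarrow> 'v) \<Rightarrow> 'a \<Rightarrow> ('v \<Rightarrow> 'v) \<Rightarrow> ('v \<Rightarrow> 'v)" where
  "end_scale scale c f = (\<lambda>x. scale c (f x))"

definition is_endo :: "('a::field \<Rightarrow> 'v::ab_group_add \<Rightarrow> 'v) \<Rightarrow> ('v \<Rightarrow> 'v) \<Rightarrow> bool" where
  "is_endo scale u \<longleftrightarrow> Vector_Spaces.linear scale scale u"

text \<open>Symmetric bilinear form (linear in the second argument and symmetric, hence bilinear).\<close>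
definition symmetric_bilinear_form ::
  "('a::field \<Rightarrow> 'v::ab_group_add \<Rightarrow> 'v) \<Rightarrow> ('v \<Rightarrow> 'v \<Rightarrow> 'a) \<Rightarrow> bool" where
  "symmetric_bilinear_form scale b \<longleftrightarrow>
     (\<forall>x. Vector_Spaces.linear scale (*) (b x)) \<and> (\<forall>x y. b x y = b y x)"

definition nondegenerate :: "('v::zero \<Rightarrow> 'v \<Rightarrow> 'a::zero) \<Rightarrow> bool" where
  "nondegenerate b \<longleftrightarrow> (\<forall>x. (\<forall>y. b x y = 0) \<longrightarrow> x = 0)"

definition totally_singular :: "('v \<Rightarrow> 'v \<Rightarrow> 'a::zero) \<Rightarrow> 'v set \<Rightarrow> bool" where
  "totally_singular b X \<longleftrightarrow> (\<forall>x\<in>X. \<forall>y\<in>X. b x y = 0)"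

definition witt_index ::
  "('a::field \<Rightarrow> 'v::ab_group_add \<Rightarrow> 'v) \<Rightarrow> ('v \<Rightarrow> 'v \<Rightarrow> 'a) \<Rightarrow> nat" where
  "witt_index scale b =
     Max {vector_space.dim scale X | X. module.subspace scale X \<and> totally_singular b X}"

definition Sym_b ::
  "('a::field \<Rightarrow> 'v::ab_group_add \<Rightarrow> 'v) \<Rightarrow> ('v \<Rightarrow> 'v \<Rightarrow> 'a) \<Rightarrow> ('v \<Rightarrow> 'v) set" where
  "Sym_b scale b = {u. is_endo scale u \<and> (\<forall>x y. b x (u y) = b y (u x))}"

definition Alt_b ::
  "('a::field \<Rightarrow> 'v::ab_group_add \<Rightarrow> 'v) \<Rightarrow> ('v \<Rightarrow> 'v \<Rightarrow> 'a) \<Rightarrow> ('v \<Rightarrow> 'v) set" where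
  "Alt_b scale b = {u. is_endo scale u \<and> (\<forall>x. b x (u x) = 0)}"

definition nilpotent_endo :: "('v::zero \<Rightarrow> 'v) \<Rightarrow> bool" where
  "nilpotent_endo u \<longleftrightarrow> (\<exists>k. (u ^^ k) = (\<lambda>_. 0))"

definition nilpotent_subspace_of ::
  "('a::field \<Rightarrow> 'v::ab_group_add \<Rightarrow> 'v) \<Rightarrow> ('v \<Rightarrow> 'v) set \<Rightarrow> ('v \<Rightarrow> 'v) set \<Rightarrow> bool" where
  "nilpotent_subspace_of scale S W \<longleftrightarrow>
     module.subspace (end_scale scale) W \<and> W \<subseteq> S \<and> (\<forall>u\<in>W. nilpotent_endo u)"

definition greatest_nilpotent_dim ::
  "('a::field \<Rightarrow> 'v::ab_group_add \<Rightarrow> 'v) \<Rightarrow> ('v \<Rightarrow> 'v) set \<Rightarrow> nat \<Rightarrow> bool" where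
  "greatest_nilpotent_dim scale S m \<longleftrightarrow>
     (\<exists>W. nilpotent_subspace_of scale S W \<and> vector_space.dim (end_scale scale) W = m) \<and>
     (\<forall>W. nilpotent_subspace_of scale S W \<longrightarrow> vector_space.dim (end_scale scale) W \<le> m)"

definition orth :: "('v \<Rightarrow> 'v \<Rightarrow> 'a::zero) \<Rightarrow> 'v set \<Rightarrow> 'v set" where
  "orth b X = {y. \<forall>x\<in>X. b x y = 0}"

definition KerQ :: "('v \<Rightarrow> 'v \<Rightarrow> 'a::zero) \<Rightarrow> 'v set" where
  "KerQ b = {x. b x x = 0}"

definition SKerQ :: "('v \<Rightarrow> 'v \<Rightarrow> 'a::zero) \<Rightarrow> 'v set" where
  "SKerQ b = KerQ b \<inter> orth b (KerQ b)"

end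

theory Submission
  imports Defs "HOL-Computational_Algebra.Polynomial"
begin

text \<open>
  Induction on the dimension of a maximal totally singular subspace \<open>F\<close> of a nondegenerate
  subspace \<open>V\<close>: pick \<open>x \<in> F\<close> nonzero and \<open>y\<^sub>0\<close> with \<open>b x y\<^sub>0 = 1\<close>, and pass to the orthogonal
  \<open>V\<^sub>1\<close> of \<open>{x, y\<^sub>0}\<close>, a copy of \<open>x\<close>-perp modulo \<open>x\<close>. For a nilpotent space \<open>W\<close>, the dimension
  splits as \<open>dim W = dim (W x) + dim M + dim W\<^sub>1\<close>, where \<open>W\<^sub>1\<close> acts on \<open>V\<^sub>1\<close> and \<open>M\<close> parametrizes
  the elements \<open>z \<mapsto> (b y z + a * b x z) x + b x z y\<close> of \<open>W\<close>. In characteristic 2 the trace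
  form carries no information between \<open>W x\<close> and \<open>M\<close>. Instead, nilpotency of \<open>u + v\<close> for \<open>u \<in> W\<close> and
  \<open>v\<close> of this rank-two shape makes a 2 by 2 determinant over the polynomial ring equal to 1, and its low
  coefficients relate \<open>b y (u x)\<close> to the values of the quadratic form at \<open>u x\<close> and \<open>y\<close>.
  In the alternating case \<open>(b y (u x))\<^sup>2 = Q (u x) Q y\<close>: off the kernel of \<open>Q\<close> this leaves room for at most
  one extra dimension on each side, which is absorbed unless \<open>n = 2\<nu> + 1\<close>; there the excess
  is controlled by \<open>dim (Ker Q)\<close>. The extremal spaces are built by reversing the induction, starting,
  when \<open>SKer Q = 0\<close> and \<open>n = 2\<nu> + 1\<close>, from the orthogonal sum of \<open>Ker Q\<close> and a line.
\<close>

section \<open>Spans and nilpotent perturbations of rank two\<close>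

text \<open>Lifts to \<open>W\<close> of a basis of its image, together with \<open>D\<close>, span
  \<open>W\<close>. Counting spanning sets instead of dimensions keeps this rank-nullity argument
  usable in the space of all functions \<open>'v \<Rightarrow> 'v\<close>, which may be
  infinite-dimensional.\<close>

lemma (in vector_space_pair) subset_span_kernel_image:
  assumes f: "Vector_Spaces.linear s1 s2 f" and W: "vs1.subspace W"
    and C: "finite C" "f ` W \<subseteq> vs2.span C"
    and D: "finite D" "{u \<in> W. f u = 0} \<subseteq> vs1.span D"
  obtains E where "finite E" "card E \<le> card C + card D" "W \<subseteq> vs1.span E"
proof -
  interpret f: Vector_Spaces.linear s1 s2 f by (rule f)
  obtain C' where C': "C' \<subseteq> f ` W" "vs2.independent C'" "f ` W \<subseteq> vs2.span C'"
    using vs2.maximal_independent_subset[of "f ` W"] by blast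
  have "C' \<subseteq> vs2.span C" using C'(1) C(2) by blast
  then have fin: "finite C'" and card: "card C' \<le> card C"
    using vs2.independent_span_bound[OF C(1) C'(2)] by auto
  have "\<forall>c\<in>C'. \<exists>w. w \<in> W \<and> f w = c" using C'(1) by auto
  then obtain g where g: "\<And>c. c \<in> C' \<Longrightarrow> g c \<in> W \<and> f (g c) = c" by metis
  have fg: "f ` g ` C' = C'" using g by force
  show thesis
  proof (rule that[of "g ` C' \<union> D"])
    show "finite (g ` C' \<union> D)" using fin D by simp
    have "card (g ` C' \<union> D) \<le> card (g ` C') + card D" by (rule card_Un_le)
    also have "card (g ` C') \<le> card C'" using fin by (rule card_image_le)
    finally show "card (g ` C' \<union> D) \<le> card C + card D" using card by simp
    show "W \<subseteq> vs1.span (g ` C' \<union> D)"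
    proof
      fix u assume u: "u \<in> W"
      then have "f u \<in> vs2.span (f ` g ` C')" using C'(3) fg by auto
      then obtain w where w: "w \<in> vs1.span (g ` C')" "f u = f w"
        using linear_span_image[OF f] by auto
      have "g ` C' \<subseteq> W" using g by auto
      then have "w \<in> W" using w(1) vs1.span_minimal[OF _ W] by blast
      then have "u - w \<in> {u \<in> W. f u = 0}"
        using u w(2) vs1.subspace_diff[OF W] by (simp add: f.diff)
      then have "u - w \<in> vs1.span D" using D(2) by blast
      then have "w + (u - w) \<in> vs1.span (g ` C' \<union> D)"
        using w(1) vs1.span_mono[of "g ` C'" "g ` C' \<union> D"] vs1.span_mono[of D "g ` C' \<union> D"]
        by (intro vs1.span_add) auto
      then show "u \<in> vs1.span (g ` C' \<union> D)" by simp
    qed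
  qed
qed

text \<open>Squeezes the dimension between a spanning bound from above and an independent set from
  below.\<close>

lemma (in vector_space) dim_eq_independent_card:
  assumes "W \<subseteq> span S" "finite S" "card S \<le> d"
    and "B \<subseteq> W" "independent B" "d \<le> card B"
  shows "dim W = d"
proof -
  obtain B' where B': "B \<subseteq> B'" "B' \<subseteq> W" "independent B'" "W \<subseteq> span B'"
    using maximal_independent_subset_extend[OF assms(4,5)] by blast
  have "finite B'" "card B' \<le> card S"
    using independent_span_bound[OF assms(2) B'(3)] B'(2) assms(1) by auto
  moreover have "card B \<le> card B'" using B'(1) \<open>finite B'\<close> by (rule card_mono[rotated])
  ultimately have "card B' = d" using assms by simp
  then show ?thesis using basis_card_eq_dim[OF B'(2) B'(4) B'(3)] by simp
qed

section \<open>Trajectory polynomials and the determinant of a rank-two perturbation\<close>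

lemma funpow_zero_mono:
  fixes u :: "'v::zero \<Rightarrow> 'v"
  assumes "(u ^^ k) z = 0" "u 0 = 0" "k \<le> j"
  shows "(u ^^ j) z = 0"
proof -
  have "(u ^^ i) 0 = 0" for i by (induction i) (simp_all add: assms(2))
  moreover have "u ^^ j = (u ^^ (j - k)) \<circ> (u ^^ k)" using assms(3) by (simp flip: funpow_add)
  ultimately show ?thesis using assms(1) by simp
qed

text \<open>Power series of \<phi> applied to the resolvent (1 - t u)^(-1) z. Nilpotency of
  \<open>u\<close> makes it a polynomial.\<close>

definition traj :: "('v \<Rightarrow> 'v) \<Rightarrow> ('v \<Rightarrow> 'a::zero) \<Rightarrow> 'v \<Rightarrow> 'a poly" where
  "traj u \<phi> z = Abs_poly (\<lambda>k. \<phi> ((u ^^ k) z))"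

lemma coeff_traj:
  fixes u :: "'v::zero \<Rightarrow> 'v"
  assumes "nilpotent_endo u" "u 0 = 0" "\<phi> 0 = 0"
  shows "coeff (traj u \<phi> z) k = \<phi> ((u ^^ k) z)"
proof -
  obtain n where n: "(u ^^ n) = (\<lambda>_. 0)" using assms(1) by (auto simp: nilpotent_endo_def)
  have "\<phi> ((u ^^ i) z) = 0" if "i > n" for i
    using funpow_zero_mono[of n u z i] n assms that by simp
  then show ?thesis unfolding traj_def by (subst coeff_Abs_poly[where n = n]) auto
qed

context vector_space
begin

text \<open>Telescoping: w^k - u^k is the sum over i < k of u^i (w - u) w^(k-1-i), and w - u takes
  values in the span of \<open>x\<close> and \<open>y\<close>.\<close>

lemma funpow_rank_two_perturbation:
  assumes u: "Vector_Spaces.linear scale scale u"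
    and w: "\<And>z. w z = u z + (scale (f z) x + scale (g z) y)"
  shows "(w ^^ k) z = (u ^^ k) z +
    (\<Sum>i<k. scale (f ((w ^^ (k - 1 - i)) z)) ((u ^^ i) x) + scale (g ((w ^^ (k - 1 - i)) z)) ((u ^^ i) y))"
proof (induction k)
  case (Suc k)
  interpret u: Vector_Spaces.linear scale scale u by (rule u)
  have "(w ^^ Suc k) z = u ((w ^^ k) z) + (scale (f ((w ^^ k) z)) x + scale (g ((w ^^ k) z)) y)"
    using w[of "(w ^^ k) z"] by simp
  moreover have "u ((w ^^ k) z) = (u ^^ Suc k) z + (\<Sum>i<k.
      scale (f ((w ^^ (k - 1 - i)) z)) ((u ^^ Suc i) x) + scale (g ((w ^^ (k - 1 - i)) z)) ((u ^^ Suc i) y))"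
    by (subst Suc) (simp add: u.add u.sum u.scale)
  ultimately show ?case
    unfolding sum.lessThan_Suc_shift by simp
qed simp

text \<open>The 2 by 2 matrices \<open>I - tM\<close> and \<open>I + tM'\<close> attached to the resolvents of \<open>u\<close> and \<open>w\<close> are
  mutually inverse by the resolvent identity. Nilpotency makes their entries polynomials, so the
  determinant is a unit of the polynomial ring with constant term 1.\<close>
lemma det_resolvent_rank_two:
  fixes f g :: "'b \<Rightarrow> 'a"
  assumes u: "Vector_Spaces.linear scale scale u" "nilpotent_endo u"
    and w: "\<And>z. w z = u z + (scale (f z) x + scale (g z) y)" "nilpotent_endo w"
    and f: "Vector_Spaces.linear scale (*) f" and g: "Vector_Spaces.linear scale (*) g"
  shows "(1 - pCons 0 (traj u f x)) * (1 - pCons 0 (traj u g y))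
      - pCons 0 (traj u f y) * pCons 0 (traj u g x) = 1" (is "?D = 1")
proof -
  interpret u: Vector_Spaces.linear scale scale u by (rule u)
  interpret f: Vector_Spaces.linear scale "(*)" f by (rule f)
  interpret g: Vector_Spaces.linear scale "(*)" g by (rule g)
  have w0: "w 0 = 0" by (simp add: w(1) u.zero f.zero g.zero)
  \<comment> \<open>Resolvent identity (1 - tw)^(-1) = (1 - tu)^(-1) + t (1 - tu)^(-1) (w - u) (1 -
    tw)^(-1), seen through \<phi>; multiplication by t is \<open>pCons 0\<close>.\<close>
  have resolvent: "traj w \<phi> z = traj u \<phi> z
      + pCons 0 (traj u \<phi> x * traj w f z + traj u \<phi> y * traj w g z)"
    if phi: "Vector_Spaces.linear scale (*) \<phi>" for \<phi> z
  proof (rule poly_eqI)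
    fix k
    interpret phi: Vector_Spaces.linear scale "(*)" \<phi> by (rule phi)
    note coeffs = coeff_traj[OF u(2) u.zero] coeff_traj[OF w(2) w0]
    show "coeff (traj w \<phi> z) k = coeff (traj u \<phi> z
        + pCons 0 (traj u \<phi> x * traj w f z + traj u \<phi> y * traj w g z)) k"
    proof (cases k)
      case (Suc m)
      have "\<phi> ((w ^^ Suc m) z) = \<phi> ((u ^^ Suc m) z) + (\<Sum>i\<le>m.
          f ((w ^^ (m - i)) z) * \<phi> ((u ^^ i) x) + g ((w ^^ (m - i)) z) * \<phi> ((u ^^ i) y))"
        unfolding funpow_rank_two_perturbation[OF u(1) w(1), of "Suc m" z] lessThan_Suc_atMost
        by (simp add: phi.add phi.sum phi.scale)
      then show ?thesis unfolding Suc
        by (simp add: coeffs f.zero g.zero phi.zero coeff_mult sum.distrib mult.commute del: funpow.simps)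
    qed (simp add: coeffs phi.zero)
  qed
  define t where "t = [:0, 1::'a:]"
  have t: "pCons 0 p = t * p" for p by (simp add: t_def)
  define A B C D where "A = traj u f x" "B = traj u f y" "C = traj u g x" "D = traj u g y"
  define A' B' C' D' where "A' = traj w f x" "B' = traj w f y" "C' = traj w g x" "D' = traj w g y"
  note defs = A_B_C_D_def A'_B'_C'_D'_def
  have 1: "A' = A + t * (A * A' + B * C')" "B' = B + t * (A * B' + B * D')"
    unfolding defs t[symmetric] by (rule resolvent[OF f])+
  have 2: "C' = C + t * (C * A' + D * C')" "D' = D + t * (C * B' + D * D')"
    unfolding defs t[symmetric] by (rule resolvent[OF g])+
  \<comment> \<open>These are the entries of (I - tM)(I + tM') = I, where M has rows (A, B) and (C,
    D) and M' is its primed counterpart.\<close>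
  have e: "(1 - t * A) * (1 + t * A') - t * B * (t * C') = 1"
    "(1 - t * A) * (t * B') - t * B * (1 + t * D') = 0"
    "- t * C * (1 + t * A') + (1 - t * D) * (t * C') = 0"
    "- t * C * (t * B') + (1 - t * D) * (1 + t * D') = 1"
    using 1 2 by algebra+
  have "((1 - t * A) * (1 - t * D) - t * B * (t * C)) *
     ((1 + t * A') * (1 + t * D') - t * B' * (t * C')) = 1"
    using e by algebra
  then have unit: "?D dvd 1" unfolding defs t by (metis dvd_triv_left)
  then obtain d where d: "?D = [:d:]" by (metis is_unit_poly_iff)
  have "coeff [:d:] 0 = 1" unfolding d[symmetric] by (simp add: coeff_mult)
  then show ?thesis unfolding d by (simp add: one_pCons)
qed

end

section \<open>Nondegenerate symmetric forms in characteristic 2\<close>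

locale nondegenerate_form = finite_dimensional_vector_space scale Basis
  for scale :: "'a::field \<Rightarrow> 'v::ab_group_add \<Rightarrow> 'v" (infixr "*s" 75) and Basis +
  fixes b :: "'v \<Rightarrow> 'v \<Rightarrow> 'a"
  assumes char2: "CHAR('a) = 2"
    and bil: "symmetric_bilinear_form scale b"
    and nd: "nondegenerate b"
begin

lemma linearI:
  assumes "\<And>x y. f (x + y) = f x + f y" "\<And>c x. f (c *s x) = c *s f x"
  shows "Vector_Spaces.linear scale scale f"
  using assms vector_space_axioms by (simp add: Vector_Spaces.linear_iff)

lemma two_eq_0: "(2::'a) = 0"
  using of_nat_CHAR[where 'a='a] char2 by simp

lemma add_self: "(a::'a) + a = 0"
  using two_eq_0 by (metis mult_2 mult_zero_left)

lemma uminus_char2: "- (a::'a) = a"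
  using add_self[of a] by (simp add: add_eq_0_iff)

lemma linear_b: "Vector_Spaces.linear scale (*) (b x)"
  using bil unfolding symmetric_bilinear_form_def by blast

lemma b_comm: "b x y = b y x"
  using bil unfolding symmetric_bilinear_form_def by blast

lemma b_right [simp]:
  "b x (y + z) = b x y + b x z" "b x (c *s y) = c * b x y" "b x 0 = 0"
  "b x (y - z) = b x y - b x z" "b x (- y) = - b x y"
proof -
  interpret f: Vector_Spaces.linear scale "(*)" "b x" by (rule linear_b)
  show "b x (y + z) = b x y + b x z" "b x (c *s y) = c * b x y" "b x 0 = 0"
    "b x (y - z) = b x y - b x z" "b x (- y) = - b x y"
    by (simp_all add: f.add f.scale f.zero f.diff f.neg)
qed

lemma b_left [simp]:
  "b (y + z) x = b y x + b z x" "b (c *s y) x = c * b y x" "b 0 x = 0"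
  "b (y - z) x = b y x - b z x" "b (- y) x = - b y x"
  by (simp_all add: b_comm[of _ x])

lemma Q_add: "b (x + y) (x + y) = b x x + b y y"
proof -
  have "b (x + y) (x + y) = b x x + b y y + (b x y + b x y)"
    by (simp add: b_comm[of y x] algebra_simps)
  then show ?thesis by (simp add: add_self)
qed

lemma subspace_KerQ: "subspace (KerQ b)"
  unfolding KerQ_def by (rule subspaceI) (simp_all add: Q_add del: b_left(1) b_right(1))

lemma subspace_orth: "subspace (orth b H)"
  unfolding orth_def by (rule subspaceI) simp_all

lemma orth_span: "\<lbrakk>\<And>h. h \<in> H \<Longrightarrow> b h v = 0; w \<in> span H\<rbrakk> \<Longrightarrow> b w v = 0"
proof -
  assume H: "\<And>h. h \<in> H \<Longrightarrow> b h v = 0" and w: "w \<in> span H"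
  have "subspace {w. b w v = 0}" by (rule subspaceI) simp_all
  then have "span H \<subseteq> {w. b w v = 0}" by (intro span_minimal) (use H in auto)
  then show ?thesis using w by auto
qed

text \<open>The induction passes to smaller spaces; they are kept as subspaces of one type, with the
  restriction of \<open>b\<close> nondegenerate.\<close>

definition nondeg_on :: "'v set \<Rightarrow> bool" where
  "nondeg_on V \<longleftrightarrow> subspace V \<and> (\<forall>x\<in>V. (\<forall>y\<in>V. b x y = 0) \<longrightarrow> x = 0)"

text \<open>Extend a basis \<open>A\<close> of \<open>H\<close> to a basis \<open>B\<close> of
  \<open>V\<close>. The map \<open>T\<close>, which uses the values b \<beta> v as coordinates, is
  injective on \<open>V\<close> by nondegeneracy, hence bijective, and carries the orthogonal of
  \<open>H\<close> in \<open>V\<close> onto the span of \<open>B - A\<close>.\<close>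

lemma dim_orth:
  assumes V: "nondeg_on V" and H: "subspace H" "H \<subseteq> V"
  shows "dim (V \<inter> orth b H) + dim H = dim V"
proof -
  have sV: "subspace V" using V by (simp add: nondeg_on_def)
  obtain A where A: "A \<subseteq> H" "independent A" "H \<subseteq> span A" "card A = dim H"
    using basis_exists by blast
  obtain B where B: "A \<subseteq> B" "B \<subseteq> V" "independent B" "V \<subseteq> span B"
    using maximal_independent_subset_extend[of A V] A H by blast
  have fin: "finite B" using B(3) by (rule finiteI_independent)
  have cardB: "card B = dim V" using B by (simp add: basis_card_eq_dim)
  define T where "T v = (\<Sum>\<beta>\<in>B. b \<beta> v *s \<beta>)" for v
  have linT: "Vector_Spaces.linear scale scale T"
    by (rule linearI) (simp_all add: T_def scale_left_distrib sum.distrib scale_sum_right)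
  interpret T: Vector_Spaces.linear scale scale T by (rule linT)
  have coeff: "b \<beta> v = c \<beta>" if "T v = (\<Sum>\<beta>\<in>B. c \<beta> *s \<beta>)" "\<beta> \<in> B" for v c \<beta>
  proof -
    have "(\<Sum>\<beta>\<in>B. (b \<beta> v - c \<beta>) *s \<beta>) = 0"
      using that(1) by (simp add: T_def scale_left_diff_distrib sum_subtractf)
    then show ?thesis using independentD[OF B(3) fin subset_refl _ that(2)] by fastforce
  qed
  have inj: "inj_on T V"
  proof (rule inj_onI)
    fix v w assume vw: "v \<in> V" "w \<in> V" "T v = T w"
    have *: "b \<beta> (v - w) = 0" if "\<beta> \<in> B" for \<beta>
      using coeff[of v "\<lambda>\<beta>. b \<beta> w"] vw(3) that by (simp add: T_def)
    have "b y (v - w) = 0" if "y \<in> V" for y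
      using orth_span[OF *] B(4) that by blast
    then have "\<forall>y\<in>V. b (v - w) y = 0" using b_comm[of "v - w"] by simp
    then have "v - w = 0"
      using V subspace_diff[OF sV vw(1,2)] unfolding nondeg_on_def by blast
    then show "v = w" by simp
  qed
  have TV: "T ` V \<subseteq> V"
    unfolding T_def using B(2) by (auto intro!: subspace_sum[OF sV] subspace_scale[OF sV])
  have spV: "span V = V" using sV by (simp add: span_eq_iff)
  interpret P: finite_dimensional_vector_space_pair_1 scale Basis scale ..
  have "dim (T ` V) = dim V"
    using P.dim_image_eq[OF linT, of V] unfolding spV using inj by blast
  then have onto: "T ` V = V"
    using subspace_dim_equal[OF T.subspace_image[OF sV] sV TV] by simp
  have img: "T ` (V \<inter> orth b H) = span (B - A)"
  proof (intro equalityI subsetI)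
    fix w assume "w \<in> T ` (V \<inter> orth b H)"
    then obtain v where v: "v \<in> orth b H" "w = T v" by auto
    have "b \<beta> v = 0" if "\<beta> \<in> A" for \<beta> using v(1) that A(1) by (auto simp: orth_def)
    then have *: "w = (\<Sum>\<beta>\<in>B - A. b \<beta> v *s \<beta>)"
      unfolding v(2) T_def by (intro sum.mono_neutral_right) (use fin in auto)
    show "w \<in> span (B - A)" unfolding *
      by (rule span_sum, rule span_scale, rule span_base)
  next
    fix w assume w: "w \<in> span (B - A)"
    then have "w \<in> V" using span_minimal[OF _ sV, of "B - A"] B(2) by blast
    then obtain v where v: "v \<in> V" "w = T v" using onto by auto
    obtain c where c: "w = (\<Sum>\<beta>\<in>B - A. c \<beta> *s \<beta>)"
      using w span_finite[of "B - A"] fin by auto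
    have "w = (\<Sum>\<beta>\<in>B. (if \<beta> \<in> A then 0 else c \<beta>) *s \<beta>)"
      unfolding c by (intro sum.mono_neutral_cong_left) (use fin in auto)
    then have *: "b \<beta> v = 0" if "\<beta> \<in> A" for \<beta>
      using coeff[of v "\<lambda>\<beta>. if \<beta> \<in> A then 0 else c \<beta>" \<beta>] v(2) that B(1) by auto
    have "b h v = 0" if "h \<in> H" for h using orth_span[OF *] A(3) that by blast
    then show "w \<in> T ` (V \<inter> orth b H)" using v by (auto simp: orth_def)
  qed
  have "span (V \<inter> orth b H) \<subseteq> V" by (rule span_minimal[OF _ sV]) simp
  then have "inj_on T (span (V \<inter> orth b H))" using inj by (rule inj_on_subset[rotated])
  then have "dim (V \<inter> orth b H) = dim (span (B - A))"
    using P.dim_image_eq[OF linT, of "V \<inter> orth b H"] unfolding img by simp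
  also have "\<dots> = card (B - A)"
    using dim_eq_card_independent[OF independent_mono[OF B(3), of "B - A"]] by auto
  also have "\<dots> = card B - card A" using B(1) by (simp add: card_Diff_subset finite_subset fin)
  finally show ?thesis using cardB A(4) card_mono[OF fin B(1)] by simp
qed

text \<open>Expands the determinant identity. Symmetry of \<open>u\<close> gives traj u (b x) y = p,
  so in characteristic 2 the linear terms p + p cancel, and so do the two products a p q(x).\<close>

lemma rank_two_relation:
  assumes u: "Vector_Spaces.linear scale scale u" "nilpotent_endo u"
    and sym: "\<And>z z'. b z (u z') = b z' (u z)"
    and w: "nilpotent_endo (\<lambda>z. u z + ((b y z + a * b x z) *s x + b x z *s y))"
  defines "p \<equiv> traj u (b y) x" and "q \<equiv> \<lambda>z. traj u (b z) z"
  shows "pCons 0 (p * p) = smult a (q x) + pCons 0 (q x * q y)"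
proof -
  interpret u: Vector_Spaces.linear scale scale u by (rule u)
  have sympow: "b z ((u ^^ k) z') = b z' ((u ^^ k) z)" for k z z'
  proof (induction k arbitrary: z z')
    case (Suc k)
    have "b z ((u ^^ Suc k) z') = b (u z) ((u ^^ k) z')"
      using sym[of z "(u ^^ k) z'"] b_comm[of "u z" "(u ^^ k) z'"] by simp
    also have "\<dots> = b z' ((u ^^ Suc k) z)"
      using Suc[of "u z" z'] by (simp add: funpow_swap1)
    finally show ?case .
  qed (simp add: b_comm)
  note coeffs = coeff_traj[OF u(2) u.zero]
  have f: "Vector_Spaces.linear scale (*) (\<lambda>z. b y z + a * b x z)"
    using linear_b[of x] by (simp add: Vector_Spaces.linear_iff distrib_left mult.left_commute)
  have 1: "traj u (\<lambda>z. b y z + a * b x z) x = p + smult a (q x)"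
    "traj u (\<lambda>z. b y z + a * b x z) y = q y + smult a p" "traj u (b x) y = p"
    unfolding p_def q_def by (auto intro!: poly_eqI simp: coeffs sympow[of x _ y])
  have 2: "p + p = 0" by (rule poly_eqI) (simp only: coeff_add add_self coeff_0)
  let ?t = "[:0, 1:]"
  have "(1 - ?t * (p + [:a:] * q x)) * (1 - ?t * p) - (?t * (q y + [:a:] * p)) * (?t * q x) = 1"
    using det_resolvent_rank_two[OF u refl w f linear_b[of x]] unfolding 1 by (simp add: q_def)
  then have "?t * (?t * (p * p)) = ?t * ([:a:] * q x + ?t * (q x * q y))"
    using 2 by algebra
  then have "?t * (p * p) = [:a:] * q x + ?t * (q x * q y)"
    by (subst (asm) mult_left_cancel) simp_all
  then show ?thesis by simp
qed

text \<open>Coefficients 1, 2 and 3 of \<open>rank_two_relation\<close>; cross terms of p * p double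
  to zero, and b x (u (u x)) = b (u x) (u x) by symmetry.\<close>

lemma rank_two_relations:
  assumes u: "Vector_Spaces.linear scale scale u" "nilpotent_endo u"
    and sym: "\<And>z z'. b z (u z') = b z' (u z)"
    and w: "nilpotent_endo (\<lambda>z. u z + ((b y z + a * b x z) *s x + b x z *s y))"
    and xx: "b x x = 0" and xy: "b x y = 0"
  shows "a * b x (u x) = 0"
    and "a * b (u x) (u x) = b x (u x) * b y y"
    and "b y (u x) ^ 2 = a * b x (u (u (u x))) + b x (u x) * b y (u y) + b (u x) (u x) * b y y"
proof -
  interpret u: Vector_Spaces.linear scale scale u by (rule u)
  note coeffs = coeff_traj[OF u(2) u.zero]
  define p where "p = traj u (b y) x"
  define q where "q = (\<lambda>z. traj u (b z) z)"
  have "coeff (pCons 0 (p * p)) k = coeff (smult a (q x) + pCons 0 (q x * q y)) k" for k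
    unfolding p_def q_def by (simp only: rank_two_relation[OF u sym w])
  from this[of 1] this[of 2] this[of 3] show "a * b x (u x) = 0"
    and "a * b (u x) (u x) = b x (u x) * b y y"
    and "b y (u x) ^ 2 = a * b x (u (u (u x))) + b x (u x) * b y (u y) + b (u x) (u x) * b y y"
    using xx xy b_comm[of y x] sym[of "x" "u x"] sym[of y "x"]
    by (simp_all add: p_def q_def coeffs coeff_mult numeral_2_eq_2 numeral_3_eq_3 power2_eq_square
       add_self add_eq_0_iff uminus_char2)
qed

section \<open>Spaces of endomorphisms and dimension estimates\<close>

sublocale E: vector_space "end_scale scale"
  by unfold_locales (auto simp: end_scale_def fun_eq_iff scale_right_distrib scale_left_distrib)

lemma end_scale_apply: "end_scale scale c u z = c *s u z"
  by (simp add: end_scale_def)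

lemma linear_eval: "Vector_Spaces.linear (end_scale scale) scale (\<lambda>u. u z)"
  using E.vector_space_axioms vector_space_axioms
  by (simp add: Vector_Spaces.linear_iff end_scale_apply)

lemma Alt_subset_Sym: "Alt_b scale b \<subseteq> Sym_b scale b"
proof
  fix u assume u: "u \<in> Alt_b scale b"
  then interpret u: Vector_Spaces.linear scale scale u by (simp add: Alt_b_def is_endo_def)
  have alt: "b z (u z) = 0" for z using u by (simp add: Alt_b_def)
  have "b x (u y) = b y (u x)" for x y
    using alt[of "x + y"] alt[of x] alt[of y]
    by (simp add: u.add add_eq_0_iff uminus_char2)
  then show "u \<in> Sym_b scale b" using u by (simp add: Sym_b_def Alt_b_def)
qed

lemma Sym_linear: "u \<in> Sym_b scale b \<Longrightarrow> Vector_Spaces.linear scale scale u"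
  by (simp add: Sym_b_def is_endo_def)

lemma Sym_adjoint: "u \<in> Sym_b scale b \<Longrightarrow> b z (u z') = b z' (u z)"
  by (simp add: Sym_b_def)

lemma Sym_funpow_adjoint:
  assumes "u \<in> Sym_b scale b"
  shows "b ((u ^^ k) z) z' = b z ((u ^^ k) z')"
proof (induction k arbitrary: z)
  case (Suc k)
  have "b ((u ^^ Suc k) z) z' = b ((u ^^ k) (u z)) z'" by (simp add: funpow_swap1)
  also have "\<dots> = b (u z) ((u ^^ k) z')" by (rule Suc)
  also have "\<dots> = b z ((u ^^ Suc k) z')"
    using Sym_adjoint[OF assms, of z "(u ^^ k) z'"] b_comm[of "u z" "(u ^^ k) z'"] by simp
  finally show ?case .
qed simp

lemma subspace_Sym: "E.subspace (Sym_b scale b)"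
  by (rule E.subspaceI)
     (auto simp: Sym_b_def is_endo_def end_scale_apply Vector_Spaces.linear_iff scale_right_distrib
       scale_left_commute ac_simps vector_space_axioms)

lemma subspace_Alt: "E.subspace (Alt_b scale b)"
  by (rule E.subspaceI)
     (auto simp: Alt_b_def is_endo_def end_scale_apply Vector_Spaces.linear_iff scale_right_distrib
       scale_left_commute ac_simps vector_space_axioms)

text \<open>A \<open>b\<close>-symmetric endomorphism with range in \<open>V\<close> vanishes on the orthogonal of \<open>V\<close>, so for
  nondegenerate \<open>V\<close> these are the symmetric endomorphisms of \<open>V\<close>, extended by zero.\<close>
definition nil_space :: "('v \<Rightarrow> 'v) set \<Rightarrow> 'v set \<Rightarrow> ('v \<Rightarrow> 'v) set \<Rightarrow> bool" where
  "nil_space S V W \<longleftrightarrow> E.subspace W \<and> (\<forall>u\<in>W. u \<in> S \<and> range u \<subseteq> V \<and> nilpotent_endo u)"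

text \<open>Maximality for inclusion, put as the absence of a further isotropic vector of
  \<open>V\<close> orthogonal to \<open>F\<close>. This form descends directly to the reduced
  space.\<close>

definition max_singular :: "'v set \<Rightarrow> 'v set \<Rightarrow> bool" where
  "max_singular V F \<longleftrightarrow> subspace F \<and> F \<subseteq> V \<and> totally_singular b F \<and>
     V \<inter> KerQ b \<inter> orth b F \<subseteq> F"

text \<open>The orthogonal of \<open>H\<close> contains not only \<open>Z\<close> but also
  \<open>x\<close>, which accounts for the extra 1.\<close>

lemma dim_orth_add_one_le:
  assumes V: "nondeg_on V" and Z: "subspace Z" "Z \<subseteq> V" and H: "subspace H" "H \<subseteq> V"
    and ZH: "\<And>h z. \<lbrakk>h \<in> H; z \<in> Z\<rbrakk> \<Longrightarrow> b h z = 0"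
    and x: "x \<in> V" "x \<notin> Z" "\<And>h. h \<in> H \<Longrightarrow> b h x = 0"
  shows "dim Z + dim H + 1 \<le> dim V"
proof -
  have "insert x Z \<subseteq> V \<inter> orth b H" using assms by (auto simp: orth_def)
  then have "dim (insert x Z) \<le> dim (V \<inter> orth b H)" by (rule dim_subset)
  moreover have "dim (insert x Z) = dim Z + 1"
    using x(2) Z(1) by (simp add: dim_insert span_eq_iff[THEN iffD2])
  ultimately show ?thesis using dim_orth[OF V H] by simp
qed

lemma dim_add_le:
  assumes "subspace A" "subspace B" "subspace C" "A \<subseteq> C" "B \<subseteq> C"
  shows "dim A + dim B \<le> dim C + dim (A \<inter> B)"
proof -
  have "{a + c |a c. a \<in> A \<and> c \<in> B} \<subseteq> C" using assms subspace_add by blast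
  then have "dim {a + c |a c. a \<in> A \<and> c \<in> B} \<le> dim C" by (rule dim_subset)
  then show ?thesis using dim_sums_Int[OF assms(1,2)] by simp
qed

lemma dim_kernel_functional:
  assumes A: "subspace A" and f: "Vector_Spaces.linear scale (*) f"
  shows "dim A \<le> dim {z \<in> A. f z = 0} + 1"
proof (cases "\<exists>e\<in>A. f e \<noteq> 0")
  case True
  interpret f: Vector_Spaces.linear scale "(*)" f by (rule f)
  from True obtain e where e: "e \<in> A" "f e \<noteq> 0" by blast
  have "A \<subseteq> span (insert e {z \<in> A. f z = 0})"
  proof
    fix z assume z: "z \<in> A"
    have "z - (f z / f e) *s e \<in> {z \<in> A. f z = 0}"
      using e z A by (simp add: f.diff f.scale subspace_diff subspace_scale)
    then have "(z - (f z / f e) *s e) + (f z / f e) *s e \<in> span (insert e {z \<in> A. f z = 0})"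
      by (intro span_add span_scale) (auto intro: span_base)
    then show "z \<in> span (insert e {z \<in> A. f z = 0})" by simp
  qed
  then have "dim A \<le> dim (span (insert e {z \<in> A. f z = 0}))" by (rule dim_subset)
  then show ?thesis by (simp add: dim_insert split: if_splits)
next
  case False
  then have "{z \<in> A. f z = 0} = A" by auto
  then show ?thesis by simp
qed

lemma subspace_kernel_functional:
  assumes A: "subspace A" and f: "Vector_Spaces.linear scale (*) f"
  shows "subspace {z \<in> A. f z = 0}"
proof -
  interpret f: Vector_Spaces.linear scale "(*)" f by (rule f)
  show ?thesis
    by (rule subspaceI) (use A in \<open>auto simp: f.zero f.add f.scale subspace_0 subspace_add subspace_scale\<close>)
qed

text \<open>For the last \<open>k\<close> with \<open>(u ^^ k) x \<notin> F\<close>, the vector \<open>(u ^^ k) x\<close> would be isotropic since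
  \<open>b ((u ^^ k) x) ((u ^^ k) x) = b x ((u ^^ (2 * k)) x)\<close>.\<close>
lemma nilpotent_image_in_singular:
  assumes u: "u \<in> Sym_b scale b" "nilpotent_endo u" "range u \<subseteq> V"
    and F: "subspace F" "V \<inter> KerQ b \<subseteq> F" and x: "\<And>f. f \<in> F \<Longrightarrow> b x f = 0"
  shows "u x \<in> F"
proof (rule ccontr)
  assume ux: "u x \<notin> F"
  interpret u: Vector_Spaces.linear scale scale u using u(1) by (rule Sym_linear)
  obtain n where n: "u ^^ n = (\<lambda>_. 0)" using u(2) by (auto simp: nilpotent_endo_def)
  define K where "K = {k. (u ^^ k) x \<notin> F \<and> k \<noteq> 0}"
  have "k < n" if "k \<in> K" for k
    using funpow_zero_mono[of n u x k] n that subspace_0[OF F(1)] u.zero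
    by (cases "k < n") (auto simp: K_def)
  then have fin: "finite K" by (meson finite_nat_set_iff_bounded)
  have "1 \<in> K" using ux by (simp add: K_def)
  define k where "k = Max K"
  have k: "k \<in> K" unfolding k_def using fin \<open>1 \<in> K\<close> by (intro Max_in) auto
  then have "k + k > k" by (simp add: K_def)
  then have "k + k \<notin> K" using Max_ge[OF fin] k_def by (metis not_le)
  then have "(u ^^ (k + k)) x \<in> F" using k by (simp add: K_def)
  then have "b x ((u ^^ (k + k)) x) = 0" by (rule x)
  then have "b ((u ^^ k) x) ((u ^^ k) x) = 0"
    using Sym_funpow_adjoint[OF u(1)] by (simp add: funpow_add)
  moreover have "(u ^^ k) x \<in> V"
    using k u(3) by (cases k) (auto simp: K_def)
  ultimately show False using F(2) k by (auto simp: K_def KerQ_def)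
qed

text \<open>The largest of the exponents on the finite set \<open>Basis\<close> works for all
  vectors.\<close>

lemma nilpotentI_local:
  assumes u: "Vector_Spaces.linear scale scale u" and loc: "\<And>z. \<exists>k. (u ^^ k) z = 0"
  shows "nilpotent_endo u"
proof -
  interpret u: Vector_Spaces.linear scale scale u by (rule u)
  obtain k where k: "\<And>z. (u ^^ k z) z = 0" using loc by metis
  define n where "n = Max (k ` Basis)"
  have lin: "Vector_Spaces.linear scale scale (u ^^ i)" for i
    by (rule linearI; induction i) (simp_all add: u.add u.scale)
  interpret un: Vector_Spaces.linear scale scale "u ^^ n" by (rule lin)
  have "subspace {z. (u ^^ n) z = 0}" by (rule subspaceI) (simp_all add: un.zero un.add un.scale)
  moreover have "Basis \<subseteq> {z. (u ^^ n) z = 0}"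
    using funpow_zero_mono[OF k u.zero] finite_Basis by (simp add: n_def subset_iff)
  ultimately have "UNIV \<subseteq> {z. (u ^^ n) z = 0}" unfolding span_Basis[symmetric] by (rule span_minimal[rotated])
  then have "u ^^ n = (\<lambda>_. 0)" by auto
  then show ?thesis unfolding nilpotent_endo_def by auto
qed

lemma nilpotent_no_fixpoint:
  assumes "nilpotent_endo u" "u x = x" shows "x = (0::'v)"
proof -
  obtain n where "u ^^ n = (\<lambda>_. 0)" using assms(1) by (auto simp: nilpotent_endo_def)
  moreover have "(u ^^ n) x = x" using assms(2) by (induction n) simp_all
  ultimately show ?thesis by simp
qed

end

section \<open>Reduction by an isotropic vector\<close>

locale isotropic_pair = nondegenerate_form scale Basis b
  for scale :: "'a::field \<Rightarrow> 'v::ab_group_add \<Rightarrow> 'v" (infixr "*s" 75) and Basis b +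
  fixes V :: "'v set" and x y\<^sub>0 :: 'v
  assumes V: "nondeg_on V" and x: "x \<in> V" "b x x = 0" and y0: "y\<^sub>0 \<in> V" "b x y\<^sub>0 = 1"
begin

definition V\<^sub>1 :: "'v set" where
  "V\<^sub>1 = {z \<in> V. b x z = 0 \<and> b y\<^sub>0 z = 0}"

text \<open>Orthogonal projection onto \<open>V\<^sub>1\<close> along the plane of \<open>x\<close>
  and \<open>y\<^sub>0\<close>. The term \<open>b y\<^sub>0 y\<^sub>0\<close> stays because in
  characteristic 2 adding a multiple of \<open>x\<close> to \<open>y\<^sub>0\<close> does not change
  its value under Q.\<close>

definition proj :: "'v \<Rightarrow> 'v" where
  "proj z = z - (b y\<^sub>0 z - b y\<^sub>0 y\<^sub>0 * b x z) *s x - b x z *s y\<^sub>0"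

definition compress :: "('v \<Rightarrow> 'v) \<Rightarrow> 'v \<Rightarrow> 'v" where
  "compress u = (\<lambda>z. proj (u (proj z)))"

lemma subspace_V: "subspace V" using V by (simp add: nondeg_on_def)

lemma b_y0_x: "b y\<^sub>0 x = 1" using y0(2) b_comm by metis

lemma x_nonzero: "x \<noteq> 0" using y0(2) by auto

lemma subspace_V1: "subspace V\<^sub>1"
  unfolding V\<^sub>1_def by (rule subspaceI) (use subspace_V in \<open>auto simp: subspace_0 subspace_add subspace_scale\<close>)

lemma V1_subset: "V\<^sub>1 \<subseteq> V" by (auto simp: V\<^sub>1_def)

lemma linear_proj: "Vector_Spaces.linear scale scale proj"
  by (rule linearI) (simp_all add: proj_def algebra_simps scale_right_diff_distrib)

lemma b_proj [simp]: "b x (proj z) = 0" "b y\<^sub>0 (proj z) = 0"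
  using x(2) y0(2) b_y0_x by (simp_all add: proj_def)

lemma proj_in_V1: "z \<in> V \<Longrightarrow> proj z \<in> V\<^sub>1"
  using b_proj[of z] subspace_diff[OF subspace_V] subspace_scale[OF subspace_V] x(1) y0(1)
  unfolding V\<^sub>1_def proj_def[of z] by blast

lemma proj_adjoint: "b (proj z) w = b z (proj w)"
  by (simp add: proj_def b_comm[of z x] b_comm[of z y\<^sub>0] algebra_simps)

lemma decompose: "z = (b y\<^sub>0 z - b y\<^sub>0 y\<^sub>0 * b x z) *s x + b x z *s y\<^sub>0 + proj z"
  by (simp add: proj_def)

lemma nondeg_V1: "nondeg_on V\<^sub>1"
  unfolding nondeg_on_def
proof (intro conjI ballI impI)
  fix z assume z: "z \<in> V\<^sub>1" "\<forall>y\<in>V\<^sub>1. b z y = 0"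
  have "b z w = 0" if "w \<in> V" for w
  proof -
    have "b z x = 0" "b z y\<^sub>0 = 0" using z(1) by (simp_all add: V\<^sub>1_def b_comm[of z x] b_comm[of z y\<^sub>0])
    then show ?thesis
      using z(2) proj_in_V1[OF that] by (subst decompose[of w]) simp
  qed
  then show "z = 0" using V z(1) V1_subset unfolding nondeg_on_def by blast
qed (rule subspace_V1)

lemma dim_V1: "dim V\<^sub>1 + 2 = dim V"
proof -
  have xy: "x \<notin> span {y\<^sub>0}"
  proof
    assume "x \<in> span {y\<^sub>0}"
    then obtain c where c: "x = c *s y\<^sub>0" by (auto simp: span_singleton)
    then have "b x x = c" using y0(2) by (metis b_right(2) mult.right_neutral)
    then show False using c x(2) x_nonzero by simp
  qed
  have "y\<^sub>0 \<noteq> 0" using y0(2) by auto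
  then have 2: "dim (span {x, y\<^sub>0}) = 2" using xy by (simp add: dim_insert)
  have sub: "span {x, y\<^sub>0} \<subseteq> V" using x y0 by (intro span_minimal subspace_V) auto
  have "V\<^sub>1 = V \<inter> orth b (span {x, y\<^sub>0})"
    using orth_span[of "{x, y\<^sub>0}"] by (auto simp: V\<^sub>1_def orth_def span_base)
  then show ?thesis using dim_orth[OF V subspace_span sub] 2 by simp
qed

lemma linear_compress: "Vector_Spaces.linear (end_scale scale) (end_scale scale) compress"
proof -
  interpret P: Vector_Spaces.linear scale scale proj by (rule linear_proj)
  show ?thesis
    using E.vector_space_axioms
    by (auto simp: Vector_Spaces.linear_iff compress_def fun_eq_iff end_scale_apply P.add P.scale)
qed

text \<open>Subtracting \<open>b y\<^sub>0 f *s x\<close> moves each f of \<open>F\<close> into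
  \<open>V\<^sub>1\<close>. A vector of \<open>V\<^sub>1\<close> orthogonal to
  \<open>F \<inter> V\<^sub>1\<close> is therefore orthogonal to all of \<open>F\<close>, and only
  the line of \<open>x\<close> is lost.\<close>

lemma max_singular_V1:
  assumes F: "max_singular V F" "x \<in> F"
  shows "max_singular V\<^sub>1 (F \<inter> V\<^sub>1)" and "dim (F \<inter> V\<^sub>1) + 1 = dim F"
proof -
  have sF: "subspace F" and FV: "F \<subseteq> V" and TS: "\<And>f g. \<lbrakk>f \<in> F; g \<in> F\<rbrakk> \<Longrightarrow> b f g = 0"
    and max: "\<And>z. \<lbrakk>z \<in> V; b z z = 0; \<And>f. f \<in> F \<Longrightarrow> b f z = 0\<rbrakk> \<Longrightarrow> z \<in> F"
    using F(1) by (auto simp: max_singular_def totally_singular_def KerQ_def orth_def)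
  have F1: "F \<inter> V\<^sub>1 = {z \<in> F. b y\<^sub>0 z = 0}" using TS F(2) FV by (auto simp: V\<^sub>1_def)
  have s1: "subspace (F \<inter> V\<^sub>1)" using sF subspace_V1 by (rule subspace_inter)
  have F_split: "f - b y\<^sub>0 f *s x \<in> F \<inter> V\<^sub>1" if "f \<in> F" for f
    unfolding F1 using that F(2) sF b_y0_x by (simp add: subspace_diff subspace_scale)
  show "max_singular V\<^sub>1 (F \<inter> V\<^sub>1)"
    unfolding max_singular_def
  proof (intro conjI s1 subsetI)
    show "totally_singular b (F \<inter> V\<^sub>1)" using TS by (simp add: totally_singular_def)
  next
    fix z assume z: "z \<in> V\<^sub>1 \<inter> KerQ b \<inter> orth b (F \<inter> V\<^sub>1)"
    have "b f z = 0" if "f \<in> F" for f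
    proof -
      have "b (f - b y\<^sub>0 f *s x) z = 0" using z F_split[OF that] unfolding orth_def by blast
      moreover have "b x z = 0" using z by (simp add: V\<^sub>1_def)
      ultimately show ?thesis by simp
    qed
    then show "z \<in> F \<inter> V\<^sub>1" using z max[of z] by (auto simp: V\<^sub>1_def KerQ_def)
  qed auto
  have "insert x (F \<inter> V\<^sub>1) \<subseteq> F" using F(2) by auto
  then have "dim (insert x (F \<inter> V\<^sub>1)) \<le> dim F" by (rule dim_subset)
  moreover have "x \<notin> V\<^sub>1" using b_y0_x by (simp add: V\<^sub>1_def)
  ultimately have "dim (F \<inter> V\<^sub>1) + 1 \<le> dim F"
    using s1 by (simp add: dim_insert span_eq_iff[THEN iffD2])
  moreover have "dim F \<le> dim (F \<inter> V\<^sub>1) + 1"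
    unfolding F1 by (rule dim_kernel_functional[OF sF linear_b])
  ultimately show "dim (F \<inter> V\<^sub>1) + 1 = dim F" by simp
qed

end

section \<open>Splitting a nilpotent space along an isotropic vector\<close>

locale nil_reduction = isotropic_pair scale Basis b V x y\<^sub>0
  for scale :: "'a::field \<Rightarrow> 'v::ab_group_add \<Rightarrow> 'v" (infixr "*s" 75) and Basis b V x y\<^sub>0 +
  fixes S W :: "('v \<Rightarrow> 'v) set"
  assumes S: "S = Sym_b scale b \<or> S = Alt_b scale b" and W: "nil_space S V W"
begin

text \<open>The chain \<open>K\<close> in \<open>W\<^sub>0\<close> in \<open>W\<close> has graded
  pieces \<open>Wx\<close> (evaluation at \<open>x\<close>), the compressions of
  \<open>W\<^sub>0\<close>, and \<open>K\<close> itself, which evaluation at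
  \<open>y\<^sub>0\<close> identifies with \<open>M\<close>.\<close>

definition W\<^sub>0 :: "('v \<Rightarrow> 'v) set" where "W\<^sub>0 = {u \<in> W. u x = 0}"
definition Wx :: "'v set" where "Wx = (\<lambda>u. u x) ` W"
definition K :: "('v \<Rightarrow> 'v) set" where "K = {u \<in> W\<^sub>0. compress u = 0}"
definition M :: "'v set" where "M = (\<lambda>u. u y\<^sub>0) ` K"

lemma subspace_W: "E.subspace W" using W by (simp add: nil_space_def)

lemma S_Sym: "S \<subseteq> Sym_b scale b" using S Alt_subset_Sym by blast

lemma W_Sym: "u \<in> W \<Longrightarrow> u \<in> Sym_b scale b"
  using W S_Sym by (auto simp: nil_space_def)

lemma W_linear: "u \<in> W \<Longrightarrow> Vector_Spaces.linear scale scale u"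
  using W_Sym Sym_linear by blast

lemma W_in_V: "u \<in> W \<Longrightarrow> u z \<in> V"
  using W by (auto simp: nil_space_def)

lemma W_nilpotent: "u \<in> W \<Longrightarrow> nilpotent_endo u"
  using W by (simp add: nil_space_def)

lemma W_adjoint: "u \<in> W \<Longrightarrow> b z (u z') = b z' (u z)"
  using W_Sym Sym_adjoint by blast

lemma subspace_W0: "E.subspace W\<^sub>0"
  using E.subspace_0[OF subspace_W] E.subspace_add[OF subspace_W] E.subspace_scale[OF subspace_W]
  by (intro E.subspaceI) (auto simp: W\<^sub>0_def end_scale_apply)

lemma subspace_K: "E.subspace K"
proof -
  interpret c: Vector_Spaces.linear "end_scale scale" "end_scale scale" compress
    by (rule linear_compress)
  show ?thesis
    using E.subspace_0[OF subspace_W0] E.subspace_add[OF subspace_W0] E.subspace_scale[OF subspace_W0]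
    by (intro E.subspaceI) (auto simp: K_def c.zero c.add c.scale)
qed

lemma subspace_eval_image: "E.subspace A \<Longrightarrow> subspace ((\<lambda>u. u z) ` A)"
proof -
  interpret e: Vector_Spaces.linear "end_scale scale" scale "\<lambda>u. u z" by (rule linear_eval)
  show "E.subspace A \<Longrightarrow> subspace ((\<lambda>u. u z) ` A)" by (rule e.subspace_image)
qed

lemma subspace_Wx: "subspace Wx"
  unfolding Wx_def by (rule subspace_eval_image[OF subspace_W])

lemma subspace_M: "subspace M"
  unfolding M_def by (rule subspace_eval_image[OF subspace_K])

lemma Wx_subset: "Wx \<subseteq> V" using W_in_V by (auto simp: Wx_def)

lemma x_notin_Wx: "x \<notin> Wx"
proof
  assume "x \<in> Wx"
  then obtain u where u: "u \<in> W" "u x = x" by (auto simp: Wx_def)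
  then show False using nilpotent_no_fixpoint[OF W_nilpotent] x_nonzero by blast
qed

lemma M_subset: "M \<subseteq> V" using W_in_V by (auto simp: M_def K_def W\<^sub>0_def)

lemma b_x_M: "Y \<in> M \<Longrightarrow> b x Y = 0"
  using W_adjoint[of _ x y\<^sub>0] by (auto simp: M_def K_def W\<^sub>0_def)

lemma b_y0_M_Alt: "\<lbrakk>S = Alt_b scale b; Y \<in> M\<rbrakk> \<Longrightarrow> b y\<^sub>0 Y = 0"
  using W by (auto simp: nil_space_def Alt_b_def M_def K_def W\<^sub>0_def)

lemma b_x_Wx_Alt: "\<lbrakk>S = Alt_b scale b; z \<in> Wx\<rbrakk> \<Longrightarrow> b x z = 0"
  using W by (auto simp: nil_space_def Alt_b_def Wx_def)

text \<open>Since the compression of \<open>u\<close> vanishes and \<open>u x = 0\<close>, each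
  \<open>u (proj z)\<close> is a multiple of \<open>x\<close>, whose factor is found by pairing with
  \<open>y\<^sub>0\<close>. So \<open>u\<close> is determined by \<open>u y\<^sub>0\<close>.\<close>

lemma K_form:
  assumes u: "u \<in> K"
  defines "a \<equiv> b y\<^sub>0 (u y\<^sub>0)"
  defines "y \<equiv> u y\<^sub>0 - a *s x"
  shows "u z = (b y z + a * b x z) *s x + b x z *s y"
proof -
  have uW: "u \<in> W" and ux: "u x = 0" and c: "compress u = 0" using u by (auto simp: K_def W\<^sub>0_def)
  interpret u: Vector_Spaces.linear scale scale u using uW by (rule W_linear)
  have bx: "b x (u y\<^sub>0) = 0" using b_x_M u by (auto simp: M_def)
  have y: "y = proj (u y\<^sub>0)" by (simp add: y_def a_def proj_def bx)
  define t where "t = u (proj z)"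
  have pt: "proj t = 0" using fun_cong[OF c, of z] by (simp add: compress_def t_def)
  have bt: "b x t = 0" using W_adjoint[OF uW, of x "proj z"] ux by (simp add: t_def)
  have "b y\<^sub>0 t = b (proj z) (u y\<^sub>0)" unfolding t_def by (rule W_adjoint[OF uW])
  also have "\<dots> = b z y" unfolding y by (rule proj_adjoint)
  also have "\<dots> = b y z" by (rule b_comm)
  finally have y0t: "b y\<^sub>0 t = b y z" .
  have t: "t = b y z *s x" by (subst decompose[of t]) (simp add: pt bt y0t)
  have "u z = u ((b y\<^sub>0 z - b y\<^sub>0 y\<^sub>0 * b x z) *s x + b x z *s y\<^sub>0 + proj z)"
    by (rule arg_cong[where f = u, OF decompose])
  also have "\<dots> = b x z *s u y\<^sub>0 + t" by (simp add: u.add u.scale ux t_def)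
  also have "u y\<^sub>0 = y + a *s x" by (simp add: y_def)
  finally show ?thesis by (simp add: t scale_right_distrib scale_left_distrib mult.commute add_ac)
qed

text \<open>An element \<open>v\<close> of \<open>K\<close> with value \<open>Y\<close> at
  \<open>y\<^sub>0\<close> has the shape of \<open>K_form\<close>, and u + v lies in
  \<open>W\<close>, hence is nilpotent: \<open>rank_two_relations\<close> applies.\<close>

lemma M_relations:
  assumes Y: "Y \<in> M" and u: "u \<in> W"
  defines "a \<equiv> b y\<^sub>0 Y"
  defines "y \<equiv> Y - a *s x"
  shows "a * b x (u x) = 0"
    and "a * b (u x) (u x) = b x (u x) * b y y"
    and "b y (u x) ^ 2 = a * b x (u (u (u x))) + b x (u x) * b y (u y) + b (u x) (u x) * b y y"
proof -
  obtain v where v: "v \<in> K" "Y = v y\<^sub>0" using Y by (auto simp: M_def)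
  have "v \<in> W" using v(1) by (simp add: K_def W\<^sub>0_def)
  then have "u + v \<in> W" using u E.subspace_add[OF subspace_W] by blast
  then have "nilpotent_endo (u + v)" by (rule W_nilpotent)
  moreover have "u + v = (\<lambda>z. u z + ((b y z + a * b x z) *s x + b x z *s y))"
  proof
    fix z show "(u + v) z = u z + ((b y z + a * b x z) *s x + b x z *s y)"
      using K_form[OF v(1), of z] by (simp add: y_def a_def v(2))
  qed
  ultimately have nil: "nilpotent_endo (\<lambda>z. u z + ((b y z + a * b x z) *s x + b x z *s y))" by simp
  have xy: "b x y = 0" using b_x_M[OF Y] x(2) by (simp add: y_def)
  note rel = rank_two_relations[OF W_linear[OF u] W_nilpotent[OF u] W_adjoint[OF u] nil x(2) xy]
  show "a * b x (u x) = 0"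
    and "a * b (u x) (u x) = b x (u x) * b y y"
    and "b y (u x) ^ 2 = a * b x (u (u (u x))) + b x (u x) * b y (u y) + b (u x) (u x) * b y y"
    by (rule rel)+
qed

lemma nil_space_compress: "nil_space S V\<^sub>1 (compress ` W\<^sub>0)"
  unfolding nil_space_def
proof (intro conjI ballI)
  interpret c: Vector_Spaces.linear "end_scale scale" "end_scale scale" compress
    by (rule linear_compress)
  show "E.subspace (compress ` W\<^sub>0)" by (rule c.subspace_image[OF subspace_W0])
next
  fix u' assume "u' \<in> compress ` W\<^sub>0"
  then obtain u where u: "u \<in> W" "u x = 0" and u': "u' = compress u" by (auto simp: W\<^sub>0_def)
  interpret u: Vector_Spaces.linear scale scale u using u(1) by (rule W_linear)
  interpret P: Vector_Spaces.linear scale scale proj by (rule linear_proj)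
  have lin: "is_endo scale u'"
    unfolding is_endo_def u' compress_def by (rule linearI) (simp_all add: u.add u.scale P.add P.scale)
  have adj: "b z (u' z') = b (proj z) (u (proj z'))" for z z'
    unfolding u' compress_def by (simp add: proj_adjoint)
  show "u' \<in> S"
  proof (rule disjE[OF S])
    assume "S = Sym_b scale b"
    then show ?thesis using lin adj W_adjoint[OF u(1)] by (simp add: Sym_b_def)
  next
    assume *: "S = Alt_b scale b"
    then have "b z (u z) = 0" for z using W u(1) by (auto simp: nil_space_def Alt_b_def)
    then show ?thesis using lin adj * by (simp add: Alt_b_def)
  qed
  show "range u' \<subseteq> V\<^sub>1"
    using W_in_V[OF u(1)] proj_in_V1 by (auto simp: u' compress_def)
  \<comment> \<open>As b x (u z) = 0, projecting u z only removes a multiple of \<open>x\<close>,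
    which \<open>u\<close> kills. Hence powers of the compression are compressions of
    powers.\<close>
  have up: "u (proj (u z)) = u (u z)" for z
  proof -
    have "b x (u z) = 0" using W_adjoint[OF u(1), of x z] u(2) by simp
    then show ?thesis by (simp add: proj_def[of "u z"] u.diff u.scale u(2))
  qed
  have pp: "proj (proj z) = proj z" for z by (simp add: proj_def[of "proj z"])
  have pow: "(u' ^^ Suc k) z = proj (u ((u ^^ k) (proj z)))" for k z
  proof (induction k)
    case (Suc k)
    then show ?case by (simp add: u' compress_def pp up)
  qed (simp add: u' compress_def)
  obtain n where "u ^^ n = (\<lambda>_. 0)" using W_nilpotent[OF u(1)] by (auto simp: nilpotent_endo_def)
  then have "u' ^^ Suc n = (\<lambda>_. 0)" using pow[of n] by (simp add: fun_eq_iff u.zero P.zero del: funpow.simps)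
  then show "nilpotent_endo u'" unfolding nilpotent_endo_def by blast
qed

text \<open>Applies \<open>subset_span_kernel_image\<close> to the chain \<open>K\<close>,
  \<open>W\<^sub>0\<close>, \<open>W\<close> from the inside out; evaluation at
  \<open>y\<^sub>0\<close> has zero kernel on \<open>K\<close> by \<open>K_form\<close>.\<close>

lemma span_bound:
  assumes C: "finite C" "compress ` W\<^sub>0 \<subseteq> E.span C"
  obtains D where "finite D" "card D \<le> dim Wx + dim M + card C" "W \<subseteq> E.span D"
proof -
  interpret EV: vector_space_pair "end_scale scale" scale
    by (rule vector_space_pair.intro[OF E.vector_space_axioms vector_space_axioms])
  interpret EE: vector_space_pair "end_scale scale" "end_scale scale"
    by (rule vector_space_pair.intro[OF E.vector_space_axioms E.vector_space_axioms])
  obtain BM where BM: "finite BM" "card BM = dim M" "M \<subseteq> span BM"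
    using basis_exists[of M] finiteI_independent by metis
  obtain Bx where Bx: "finite Bx" "card Bx = dim Wx" "Wx \<subseteq> span Bx"
    using basis_exists[of Wx] finiteI_independent by metis
  have "{u \<in> K. u y\<^sub>0 = 0} \<subseteq> E.span {}"
  proof clarify
    fix u assume u: "u \<in> K" "u y\<^sub>0 = 0"
    have "u z = 0" for z using K_form[OF u(1), of z] u(2) by simp
    then have "u = 0" by (simp add: fun_eq_iff)
    then show "u \<in> E.span {}" by simp
  qed
  then obtain DK where DK: "finite DK" "card DK \<le> card BM" "K \<subseteq> E.span DK"
    using EV.subset_span_kernel_image[OF linear_eval[of y\<^sub>0] subspace_K BM(1), of "{}"] BM(3)
    by (auto simp: M_def)
  have "{u \<in> W\<^sub>0. compress u = 0} \<subseteq> E.span DK" using DK(3) by (simp add: K_def)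
  then obtain D0 where D0: "finite D0" "card D0 \<le> card C + card DK" "W\<^sub>0 \<subseteq> E.span D0"
    using EE.subset_span_kernel_image[OF linear_compress subspace_W0 C DK(1)] by blast
  have "(\<lambda>u. u x) ` W \<subseteq> span Bx" "{u \<in> W. u x = 0} \<subseteq> E.span D0"
    using Bx(3) D0(3) by (simp_all add: Wx_def W\<^sub>0_def)
  then obtain D where "finite D" "card D \<le> card Bx + card D0" "W \<subseteq> E.span D"
    using EV.subset_span_kernel_image[OF linear_eval[of x] subspace_W Bx(1) _ D0(1)] by blast
  then show thesis using that[of D] BM(2) Bx(2) DK(2) D0(2) by simp
qed

section \<open>Dimension counts for \<open>Wx\<close> and \<open>M\<close>\<close>

lemma b_M_x: "Y \<in> M \<Longrightarrow> b Y x = 0"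
  using b_x_M b_comm[of Y x] by simp

text \<open>The vector \<open>x\<close> can be added on both sides: to \<open>H\<close>, as it is
  not in \<open>M\<close>, and to \<open>Z\<close>, as it is not in \<open>Wx\<close>. This gives
  the 2.\<close>

lemma count_insert:
  assumes xM: "x \<notin> M" and Z: "subspace Z" "Z \<subseteq> Wx" and H: "subspace H" "H \<subseteq> M"
    and ZH: "\<And>Y z. \<lbrakk>Y \<in> H; z \<in> Z\<rbrakk> \<Longrightarrow> b Y z = 0" and Zx: "\<And>z. z \<in> Z \<Longrightarrow> b x z = 0"
  shows "dim Z + dim H + 2 \<le> dim V"
proof -
  have sub: "span (insert x H) \<subseteq> V"
    using x(1) H(2) M_subset by (intro span_minimal subspace_V) auto
  have orthZ: "b h z = 0" if "h \<in> span (insert x H)" "z \<in> Z" for h z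
    using ZH[OF _ that(2)] Zx[OF that(2)] by (intro orth_span[OF _ that(1)]) auto
  have orthx: "b h x = 0" if "h \<in> span (insert x H)" for h
    using x(2) b_M_x H(2) by (intro orth_span[OF _ that]) auto
  have "x \<notin> span H" using xM H by (auto simp: span_eq_iff[THEN iffD2])
  then have "dim (span (insert x H)) = dim H + 1" by (simp add: dim_insert)
  moreover have "dim Z + dim (span (insert x H)) + 1 \<le> dim V"
    using Z Wx_subset x_notin_Wx orthZ orthx
    by (intro dim_orth_add_one_le[OF V _ _ subspace_span sub _ x(1)]) auto
  ultimately show ?thesis by simp
qed

text \<open>Under these assumptions the third relation of \<open>M_relations\<close> reads b Y z
  squared = 0, so \<open>M\<close> and \<open>Wx\<close> are orthogonal.\<close>

lemma Q_Wx_zero_count: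
  assumes xM: "x \<notin> M" and M: "\<And>Y. Y \<in> M \<Longrightarrow> b y\<^sub>0 Y = 0"
    and Wx: "\<And>z. z \<in> Wx \<Longrightarrow> b x z = 0" "\<And>z. z \<in> Wx \<Longrightarrow> b z z = 0"
  shows "dim Wx + dim M + 2 \<le> dim V"
proof (rule count_insert[OF xM subspace_Wx subset_refl subspace_M subset_refl _ Wx(1)])
  fix Y z assume Y: "Y \<in> M" and z: "z \<in> Wx"
  then obtain u where u: "u \<in> W" "z = u x" by (auto simp: Wx_def)
  show "b Y z = 0"
    using M_relations(3)[OF Y u(1)] M[OF Y] Wx(1)[OF z] Wx(2)[OF z] u(2) by simp
qed

text \<open>If \<open>x\<close> is in \<open>M\<close>, full orthogonality holds and
  \<open>x\<close> enlarges only one side. Otherwise \<open>x\<close> enlarges both sides, and at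
  worst one hyperplane has to be taken in \<open>M\<close> or in \<open>Wx\<close> to make the
  spaces orthogonal.\<close>

lemma count_Sym: "dim Wx + dim M + 1 \<le> dim V"
proof (cases "x \<in> M")
  case True
  \<comment> \<open>For Y = x the relations are taken with a = 1 and y = 0.\<close>
  have rel: "b x (u x) = 0" "b (u x) (u x) = 0" "b x (u (u (u x))) = 0" if "u \<in> W" for u
    using M_relations[OF True that] b_y0_x by simp_all
  have "b Y z = 0" if Y: "Y \<in> M" and z: "z \<in> Wx" for Y z
  proof -
    obtain u where u: "u \<in> W" "z = u x" using z by (auto simp: Wx_def)
    have "b (Y - b y\<^sub>0 Y *s x) (u x) ^ 2 = 0"
      unfolding M_relations(3)[OF Y u(1)] using rel[OF u(1)] by simp
    then show ?thesis using rel(1)[OF u(1)] u(2) by simp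
  qed
  then show ?thesis
    using x_notin_Wx b_M_x
    by (intro dim_orth_add_one_le[OF V subspace_Wx Wx_subset subspace_M M_subset _ x(1)]) auto
next
  case xM: False
  show ?thesis
  proof (cases "\<exists>Y\<in>M. b y\<^sub>0 Y \<noteq> 0")
    case True
    then obtain Y0 where Y0: "Y0 \<in> M" "b y\<^sub>0 Y0 \<noteq> 0" by blast
    have rel: "b x (u x) = 0" "b (u x) (u x) = 0" if "u \<in> W" for u
      using M_relations(1,2)[OF Y0(1) that] Y0(2) by simp_all
    \<comment> \<open>On this hyperplane a = 0, and the right-hand side of the third relation
      vanishes by \<open>rel\<close>.\<close>
    define H where "H = {Y \<in> M. b y\<^sub>0 Y = 0}"
    have H: "subspace H" "dim M \<le> dim H + 1"
      unfolding H_def using subspace_kernel_functional[OF subspace_M linear_b]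
        dim_kernel_functional[OF subspace_M linear_b] by auto
    have "b Y z = 0" if "Y \<in> H" and z: "z \<in> Wx" for Y z
    proof -
      obtain u where u: "u \<in> W" "z = u x" using z by (auto simp: Wx_def)
      have Y: "Y \<in> M" "b y\<^sub>0 Y = 0" using that by (auto simp: H_def)
      show ?thesis using M_relations(3)[OF Y(1) u(1)] rel[OF u(1)] Y(2) u(2) by simp
    qed
    then have "dim Wx + dim H + 2 \<le> dim V"
      using rel by (intro count_insert[OF xM subspace_Wx _ H(1)]) (auto simp: H_def Wx_def)
    then show ?thesis using H(2) by simp
  next
    case False
    then have a0: "b y\<^sub>0 Y = 0" if "Y \<in> M" for Y using that by blast
    have rel2: "b x (u x) * b Y Y = 0" if "Y \<in> M" "u \<in> W" for Y u
      using M_relations(2)[OF that] a0[OF that(1)] by simp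
    have rel3: "b Y (u x) ^ 2 = b x (u x) * b Y (u Y) + b (u x) (u x) * b Y Y"
      if "Y \<in> M" "u \<in> W" for Y u
      using M_relations(3)[OF that] a0[OF that(1)] by simp
    show ?thesis
    proof (cases "\<exists>u\<in>W. b x (u x) \<noteq> 0")
      case True
      \<comment> \<open>Q vanishes on \<open>M\<close>, so the loss is moved to \<open>Wx\<close>:
        only the part orthogonal to \<open>x\<close> is orthogonal to \<open>M\<close>.\<close>
      then have QM: "b Y Y = 0" if "Y \<in> M" for Y using rel2[OF that] by auto
      define Z where "Z = {z \<in> Wx. b x z = 0}"
      have Z: "subspace Z" "dim Wx \<le> dim Z + 1"
        unfolding Z_def using subspace_kernel_functional[OF subspace_Wx linear_b]
          dim_kernel_functional[OF subspace_Wx linear_b] by auto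
      have "b Y z = 0" if Y: "Y \<in> M" and z: "z \<in> Z" for Y z
      proof -
        obtain u where u: "u \<in> W" "z = u x" "b x (u x) = 0" using z by (auto simp: Wx_def Z_def)
        show ?thesis using rel3[OF Y u(1)] QM[OF Y] u(2,3) by simp
      qed
      then have "dim Z + dim M + 2 \<le> dim V"
        by (intro count_insert[OF xM Z(1) _ subspace_M]) (auto simp: Z_def)
      then show ?thesis using Z(2) by simp
    next
      case False
      then have Wx0: "b x z = 0" if "z \<in> Wx" for z using that by (auto simp: Wx_def)
      show ?thesis
      proof (cases "\<exists>u\<in>W. b (u x) (u x) \<noteq> 0")
        case True
        then obtain u0 where u0: "u0 \<in> W" "b (u0 x) (u0 x) \<noteq> 0" by blast
        \<comment> \<open>For Y orthogonal to u0 x the third relation at u0 forces Q Y = 0, and then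
          at every u it forces b Y (u x) = 0.\<close>
        define H where "H = {Y \<in> M. b (u0 x) Y = 0}"
        have H: "subspace H" "dim M \<le> dim H + 1"
          unfolding H_def using subspace_kernel_functional[OF subspace_M linear_b]
            dim_kernel_functional[OF subspace_M linear_b] by auto
        have "b Y z = 0" if "Y \<in> H" and z: "z \<in> Wx" for Y z
        proof -
          obtain u where u: "u \<in> W" "z = u x" using z by (auto simp: Wx_def)
          have Y: "Y \<in> M" "b Y (u0 x) = 0" using that b_comm[of "u0 x" Y] by (auto simp: H_def)
          have "b x (u0 x) = 0" using Wx0 u0(1) by (auto simp: Wx_def)
          then have "b Y Y = 0" using rel3[OF Y(1) u0(1)] Y(2) u0(2) by simp
          then show ?thesis using rel3[OF Y(1) u(1)] Wx0[OF z] u(2) by simp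
        qed
        then have "dim Wx + dim H + 2 \<le> dim V"
          using Wx0 by (intro count_insert[OF xM subspace_Wx _ H(1)]) (auto simp: H_def)
        then show ?thesis using H(2) by simp
      next
        case False
        then show ?thesis
          using Q_Wx_zero_count[OF xM a0 Wx0] by (force simp: Wx_def)
      qed
    qed
  qed
qed

lemma x_notin_M_Alt: "S = Alt_b scale b \<Longrightarrow> x \<notin> M"
  using b_y0_M_Alt b_y0_x by fastforce

text \<open>Both \<open>W x\<close> and \<open>L = M + x\<close> are filtered by \<open>F\<close> and \<open>P\<close>, the orthogonal of \<open>F\<close>, and the graded
  pieces are paired in reverse order. Only the middle pieces, in the anisotropic space \<open>P / F\<close>, need
  not be orthogonal; then both are lines, which is harmless as soon as \<open>dim (P / F) \<ge> 2\<close>.\<close>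
lemma count_Alt:
  assumes Alt: "S = Alt_b scale b" and F: "max_singular V F" "x \<in> F"
    and n: "dim V \<noteq> 2 * dim F + 1"
  shows "dim Wx + dim M + 2 \<le> dim V"
proof -
  have sF: "subspace F" and FV: "F \<subseteq> V" and TS: "\<And>f g. \<lbrakk>f \<in> F; g \<in> F\<rbrakk> \<Longrightarrow> b f g = 0"
    and max: "V \<inter> KerQ b \<inter> orth b F \<subseteq> F"
    using F(1) by (auto simp: max_singular_def totally_singular_def)
  define L where "L = span (insert x M)"
  have sL: "subspace L" by (simp add: L_def)
  have "x \<notin> span M" using x_notin_M_Alt[OF Alt] subspace_M by (simp add: span_eq_iff[THEN iffD2])
  then have dimL: "dim L = dim M + 1" by (simp add: L_def dim_insert)
  have LV: "L \<subseteq> V" unfolding L_def using x(1) M_subset by (intro span_minimal subspace_V) auto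
  have Lx: "b y x = 0" if "y \<in> L" for y
    using x(2) b_M_x by (intro orth_span[OF _ that[unfolded L_def]]) auto
  \<comment> \<open>Adding a multiple of \<open>x\<close> to Y changes neither Q Y nor b Y z, so the
    relation passes from \<open>M\<close> to \<open>L\<close>.\<close>
  have rel: "b y z ^ 2 = b y y * b z z" if y: "y \<in> L" and z: "z \<in> Wx" for y z
  proof -
    obtain k where "y - k *s x \<in> span M" using y span_breakdown_eq unfolding L_def by blast
    then have "y - k *s x \<in> M" unfolding span_eq_iff[THEN iffD2, OF subspace_M] .
    then obtain Y where Y: "Y \<in> M" "y = Y + k *s x" using that[of "y - k *s x"] by simp
    obtain u where u: "u \<in> W" "z = u x" using z by (auto simp: Wx_def)
    have "b y y = b Y Y" unfolding Y(2) Q_add using x(2) by simp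
    moreover have "b y z = b Y z" unfolding Y(2) using b_x_Wx_Alt[OF Alt z] by simp
    moreover have "b Y z ^ 2 = b z z * b Y Y"
      using M_relations(3)[OF Y(1) u(1)] b_y0_M_Alt[OF Alt Y(1)] b_x_Wx_Alt[OF Alt z] u(2) by simp
    ultimately show ?thesis by (simp add: mult.commute)
  qed
  define P where "P = V \<inter> orth b F"
  have sP: "subspace P" unfolding P_def by (rule subspace_inter[OF subspace_V subspace_orth])
  have dimP: "dim P + dim F = dim V" unfolding P_def by (rule dim_orth[OF V sF FV])
  have FP: "F \<subseteq> P" using FV TS by (auto simp: P_def orth_def)
  have PF: "z \<in> F" if "z \<in> P" "b z z = 0" for z using max that by (auto simp: P_def KerQ_def)
  have s: "subspace (L \<inter> F)" "subspace (Wx \<inter> F)" "subspace (L \<inter> P)" "subspace (Wx \<inter> P)"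
    using sL sF sP subspace_Wx by (auto intro: subspace_inter)
  \<comment> \<open>\<open>Wx\<close> and \<open>P\<close> both lie in the orthogonal of
    \<open>L \<inter> F\<close>: Q y = 0 turns \<open>rel\<close> into b y z = 0.\<close>
  have 1: "dim Wx + dim P + dim (L \<inter> F) \<le> dim V + dim (Wx \<inter> P)"
  proof -
    have "b y z = 0" if "y \<in> L \<inter> F" "z \<in> Wx" for y z
      using rel[of y z] TS[of y y] that by simp
    then have "Wx \<subseteq> V \<inter> orth b (L \<inter> F)" using Wx_subset by (auto simp: orth_def)
    moreover have "P \<subseteq> V \<inter> orth b (L \<inter> F)" by (auto simp: P_def orth_def)
    ultimately have "dim Wx + dim P \<le> dim (V \<inter> orth b (L \<inter> F)) + dim (Wx \<inter> P)"
      by (rule dim_add_le[OF subspace_Wx sP subspace_inter[OF subspace_V subspace_orth]])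
    moreover have "L \<inter> F \<subseteq> V" using LV by auto
    ultimately show ?thesis using dim_orth[OF V s(1)] by simp
  qed
  \<comment> \<open>The same with the roles exchanged. The extra 1 comes from \<open>x\<close>,
    which lies in \<open>F\<close> and is orthogonal to \<open>L\<close>, but is not in
    \<open>Wx\<close>.\<close>
  have 2: "dim L + dim P + dim (Wx \<inter> F) + 1 \<le> dim V + dim (L \<inter> P)"
  proof -
    define G where "G = span (insert x (Wx \<inter> F))"
    have "x \<notin> span (Wx \<inter> F)" using x_notin_Wx s(2) by (auto simp: span_eq_iff[THEN iffD2])
    then have dimG: "dim G = dim (Wx \<inter> F) + 1" by (simp add: G_def dim_insert)
    have GF: "G \<subseteq> F" unfolding G_def using F(2) by (intro span_minimal sF) auto
    have "b h y = 0" if "h \<in> G" "y \<in> L" for h y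
    proof (rule orth_span[OF _ that(1)[unfolded G_def]])
      fix h assume "h \<in> insert x (Wx \<inter> F)"
      then show "b h y = 0"
      proof
        assume "h = x" then show ?thesis using Lx[OF that(2)] b_comm[of x y] by simp
      next
        assume h: "h \<in> Wx \<inter> F"
        then have "b y h ^ 2 = 0" using rel[OF that(2), of h] TS[of h h] by simp
        then show ?thesis using b_comm[of h y] by simp
      qed
    qed
    then have "L \<subseteq> V \<inter> orth b G" using LV by (auto simp: orth_def)
    moreover have "P \<subseteq> V \<inter> orth b G" using GF by (auto simp: P_def orth_def)
    ultimately have "dim L + dim P \<le> dim (V \<inter> orth b G) + dim (L \<inter> P)"
      by (rule dim_add_le[OF sL sP subspace_inter[OF subspace_V subspace_orth]])
    moreover have "dim (V \<inter> orth b G) + dim G = dim V"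
      using GF FV by (intro dim_orth[OF V]) (auto simp: G_def)
    ultimately show ?thesis using dimG by simp
  qed
  have 3: "dim (A \<inter> P) + dim F \<le> dim (A \<inter> F) + dim P" if "subspace A" for A
  proof -
    have "A \<inter> P \<inter> F = A \<inter> F" using FP by blast
    then show ?thesis
      using dim_add_le[OF subspace_inter[OF that sP] sF sP _ FP] by simp
  qed
  \<comment> \<open>Vectors of \<open>A \<inter> P\<close> orthogonal to y have Q = 0 by
    \<open>rel\<close>, so they lie in \<open>F\<close>; modulo \<open>F\<close> at most a line
    remains.\<close>
  have 4: "dim (A \<inter> P) \<le> dim (A \<inter> F) + 1"
    if A: "subspace A" and y: "b y y \<noteq> 0" and rel: "\<And>z. z \<in> A \<Longrightarrow> b y z ^ 2 = b y y * b z z" for A y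
  proof -
    have "{z \<in> A \<inter> P. b y z = 0} \<subseteq> A \<inter> F" using rel y PF by fastforce
    then have "dim {z \<in> A \<inter> P. b y z = 0} \<le> dim (A \<inter> F)" by (rule dim_subset)
    then show ?thesis
      using dim_kernel_functional[OF subspace_inter[OF A sP] linear_b[of y]] by simp
  qed
  \<comment> \<open>The middle pieces: either one of them is zero and \<open>3\<close> bounds the
    other, or both are lines inside P / F, of dimension at least 2.\<close>
  have 5: "dim (L \<inter> P) + dim (Wx \<inter> P) + dim F \<le> dim (L \<inter> F) + dim (Wx \<inter> F) + dim P"
  proof (cases "(\<exists>y\<in>L \<inter> P. b y y \<noteq> 0) \<and> (\<exists>z\<in>Wx \<inter> P. b z z \<noteq> 0)")
    case True
    then obtain y z where yz: "y \<in> L" "y \<in> P" "b y y \<noteq> 0" "z \<in> Wx" "b z z \<noteq> 0" by blast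
    have "dim (Wx \<inter> P) \<le> dim (Wx \<inter> F) + 1" using rel yz by (intro 4[OF subspace_Wx, of y]) auto
    moreover have "dim (L \<inter> P) \<le> dim (L \<inter> F) + 1"
    proof (rule 4[OF sL yz(5)])
      fix w assume "w \<in> L"
      then show "b z w ^ 2 = b z z * b w w"
        using rel[of w z] yz(4) b_comm[of z w] by (simp add: mult.commute)
    qed
    \<comment> \<open>The anisotropic y excludes P = F, and the assumption \<open>n\<close> excludes
      dim P = dim F + 1.\<close>
    moreover have "dim F + 2 \<le> dim P"
    proof -
      have "y \<notin> F" using yz(3) TS by blast
      then have "dim F < dim P"
        using subspace_dim_equal[OF sF sP FP] yz(2) by (cases "dim F < dim P") auto
      then show ?thesis using n dimP by simp
    qed
    ultimately show ?thesis by simp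
  next
    case False
    then consider "L \<inter> P \<subseteq> F" | "Wx \<inter> P \<subseteq> F" using PF by blast
    then show ?thesis
    proof cases
      case 1
      then have "L \<inter> P = L \<inter> F" using FP by blast
      then show ?thesis using 3[OF subspace_Wx] by simp
    next
      case 2
      then have "Wx \<inter> P = Wx \<inter> F" using FP by blast
      then show ?thesis using 3[OF sL] by simp
    qed
  qed
  show ?thesis using 1 2 5 dimP dimL by linarith
qed

end

section \<open>Upper bounds\<close>

context isotropic_pair
begin

text \<open>Two strict inclusions: \<open>x\<close> is added to
  \<open>V\<^sub>1 \<inter> KerQ b\<close> inside its own orthogonal, then \<open>k\<close> leaves
  that orthogonal.\<close>

lemma dim_KerQ_V1:
  assumes k: "k \<in> V \<inter> KerQ b" "b x k \<noteq> 0"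
  shows "dim (V\<^sub>1 \<inter> KerQ b) + 2 \<le> dim (V \<inter> KerQ b)"
proof -
  define A where "A = {z \<in> V \<inter> KerQ b. b x z = 0}"
  have sA: "subspace A"
    unfolding A_def by (rule subspace_kernel_functional[OF subspace_inter[OF subspace_V subspace_KerQ] linear_b])
  have "insert x (V\<^sub>1 \<inter> KerQ b) \<subseteq> A" using x by (auto simp: A_def V\<^sub>1_def KerQ_def)
  then have "dim (insert x (V\<^sub>1 \<inter> KerQ b)) \<le> dim A" by (rule dim_subset)
  moreover have "x \<notin> span (V\<^sub>1 \<inter> KerQ b)"
    unfolding span_eq_iff[THEN iffD2, OF subspace_inter[OF subspace_V1 subspace_KerQ]]
    using b_y0_x by (simp add: V\<^sub>1_def)
  ultimately have 1: "dim (V\<^sub>1 \<inter> KerQ b) + 1 \<le> dim A" by (simp add: dim_insert)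
  have "insert k A \<subseteq> V \<inter> KerQ b" using k by (auto simp: A_def)
  then have "dim (insert k A) \<le> dim (V \<inter> KerQ b)" by (rule dim_subset)
  moreover have "k \<notin> span A"
    unfolding span_eq_iff[THEN iffD2, OF sA] using k(2) by (simp add: A_def)
  ultimately show ?thesis using 1 by (simp add: dim_insert)
qed

text \<open>When \<open>x\<close> is in the radical of \<open>V \<inter> KerQ b\<close>, only the
  condition at \<open>y\<^sub>0\<close> cuts this space down.\<close>

lemma dim_KerQ_V1_radical:
  assumes "\<And>k. k \<in> V \<inter> KerQ b \<Longrightarrow> b x k = 0"
  shows "dim (V \<inter> KerQ b) \<le> dim (V\<^sub>1 \<inter> KerQ b) + 1"
proof -
  have "V\<^sub>1 \<inter> KerQ b = {z \<in> V \<inter> KerQ b. b y\<^sub>0 z = 0}" using assms by (auto simp: V\<^sub>1_def)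
  then show ?thesis
    using dim_kernel_functional[OF subspace_inter[OF subspace_V subspace_KerQ] linear_b[of y\<^sub>0]] by simp
qed

end

context nondegenerate_form
begin

lemma isotropic_pair_exists:
  assumes "nondeg_on V" "x \<in> V" "x \<noteq> 0" "b x x = 0"
  obtains y\<^sub>0 where "isotropic_pair scale Basis b V x y\<^sub>0"
proof -
  obtain y where y: "y \<in> V" "b x y \<noteq> 0" using assms unfolding nondeg_on_def by blast
  have "isotropic_pair scale Basis b V x (inverse (b x y) *s y)"
    by unfold_locales (use assms y in \<open>auto simp: nondeg_on_def intro: subspace_scale\<close>)
  then show thesis by (rule that)
qed

lemma exists_nonzero:
  assumes "Suc k = dim F" shows "\<exists>x\<in>F. x \<noteq> 0"
proof (rule ccontr)
  assume "\<not> (\<exists>x\<in>F. x \<noteq> 0)"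
  then have "F \<subseteq> {0}" by auto
  then have "dim F = 0" by (simp only: dim_eq_0)
  then show False using assms by linarith
qed

lemma max_singular_isotropic: "\<lbrakk>max_singular V F; x \<in> F\<rbrakk> \<Longrightarrow> x \<in> V \<and> b x x = 0"
  unfolding max_singular_def totally_singular_def by blast

text \<open>Base case: with F = 0 there is no nonzero isotropic vector in \<open>V\<close>, and
  \<open>nilpotent_image_in_singular\<close> puts every value of \<open>u\<close> in the zero
  space.\<close>

lemma nil_space_anisotropic:
  assumes F: "max_singular V F" "dim F = 0" and S: "S \<subseteq> Sym_b scale b" and W: "nil_space S V W"
  shows "W \<subseteq> E.span {}"
proof
  fix u assume u: "u \<in> W"
  have "F = {0}"
    using F(1) dim_eq_0[of F] F(2) subspace_0[of F] unfolding max_singular_def by blast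
  then have "orth b F = UNIV" by (simp add: orth_def)
  then have KF: "V \<inter> KerQ b \<subseteq> {0}" using F(1) \<open>F = {0}\<close> unfolding max_singular_def by simp
  have u': "u \<in> Sym_b scale b" "nilpotent_endo u" "range u \<subseteq> V"
    using W u S unfolding nil_space_def by blast+
  have "u z \<in> {0}" for z
    by (rule nilpotent_image_in_singular[OF u' subspace_single_0 KF]) simp
  then have "u = 0" by (simp add: fun_eq_iff)
  then show "u \<in> E.span {}" by simp
qed

text \<open>The number m = dim V - 2 dim F is unchanged by the reduction. Each step costs at most
  dim V - 1, by \<open>count_Sym\<close>, and the costs add up to the stated product.\<close>

lemma upper_Sym:
  assumes "nondeg_on V" "max_singular V F" "nil_space (Sym_b scale b) V W" "dim V = 2 * dim F + m"
  shows "\<exists>C. finite C \<and> card C \<le> dim F * (dim F + m) \<and> W \<subseteq> E.span C"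
  using assms
proof (induction "dim F" arbitrary: V F W)
  case 0
  show ?case
    by (rule exI[of _ "{}"])
      (intro conjI nil_space_anisotropic[OF 0(3) 0(1)[symmetric] subset_refl 0(4)]; simp)
next
  case (Suc k)
  obtain x where xF: "x \<in> F" "x \<noteq> 0" using exists_nonzero[OF Suc.hyps(2)] by blast
  then obtain y0 where "isotropic_pair scale Basis b V x y0"
    using isotropic_pair_exists[OF Suc.prems(1)] max_singular_isotropic[OF Suc.prems(2) xF(1)] by blast
  then interpret isotropic_pair scale Basis b V x y0 .
  interpret nil_reduction scale Basis b V x y0 "Sym_b scale b" W
    by unfold_locales (use Suc.prems(3) in auto)
  note F1 = max_singular_V1[OF Suc.prems(2) xF(1)]
  have k: "k = dim (F \<inter> V\<^sub>1)" using F1(2) Suc.hyps(2) by simp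
  then obtain C where C: "finite C" "card C \<le> k * (k + m)" "compress ` W\<^sub>0 \<subseteq> E.span C"
    using Suc.hyps(1)[OF k nondeg_V1 F1(1) nil_space_compress] dim_V1 Suc.prems(4) Suc.hyps(2) by auto
  obtain D where D: "finite D" "card D \<le> dim Wx + dim M + card C" "W \<subseteq> E.span D"
    using span_bound[OF C(1,3)] .
  have "card D + 1 \<le> dim V + k * (k + m)" using D(2) C(2) count_Sym by linarith
  also have "\<dots> = dim F * (dim F + m) + 1"
    unfolding Suc.prems(4) Suc.hyps(2)[symmetric] by (simp add: algebra_simps)
  finally show ?case using D(1,3) by auto
qed

text \<open>As m stays different from 1 along the reduction, \<open>count_Alt\<close> limits each
  step to dim V - 2.\<close>

lemma upper_Alt:
  assumes "nondeg_on V" "max_singular V F" "nil_space (Alt_b scale b) V W" "dim V = 2 * dim F + m" "m \<noteq> 1"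
  shows "\<exists>C. finite C \<and> card C \<le> dim F * (dim F + m - 1) \<and> W \<subseteq> E.span C"
  using assms
proof (induction "dim F" arbitrary: V F W)
  case 0
  show ?case
    by (rule exI[of _ "{}"])
      (intro conjI nil_space_anisotropic[OF 0(3) 0(1)[symmetric] Alt_subset_Sym 0(4)]; simp)
next
  case (Suc k)
  obtain x where xF: "x \<in> F" "x \<noteq> 0" using exists_nonzero[OF Suc.hyps(2)] by blast
  then obtain y0 where "isotropic_pair scale Basis b V x y0"
    using isotropic_pair_exists[OF Suc.prems(1)] max_singular_isotropic[OF Suc.prems(2) xF(1)] by blast
  then interpret isotropic_pair scale Basis b V x y0 .
  interpret nil_reduction scale Basis b V x y0 "Alt_b scale b" W
    by unfold_locales (use Suc.prems(3) in auto)
  note F1 = max_singular_V1[OF Suc.prems(2) xF(1)]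
  have k: "k = dim (F \<inter> V\<^sub>1)" using F1(2) Suc.hyps(2) by simp
  then obtain C where C: "finite C" "card C \<le> k * (k + m - 1)" "compress ` W\<^sub>0 \<subseteq> E.span C"
    using Suc.hyps(1)[OF k nondeg_V1 F1(1) nil_space_compress _ Suc.prems(5)] dim_V1 Suc.prems(4) Suc.hyps(2)
    by auto
  obtain D where D: "finite D" "card D \<le> dim Wx + dim M + card C" "W \<subseteq> E.span D"
    using span_bound[OF C(1,3)] .
  have "dim Wx + dim M + 2 \<le> dim V"
    using count_Alt[OF refl Suc.prems(2) xF(1)] Suc.prems(4,5) by simp
  then have "card D + 2 \<le> dim V + k * (k + m - 1)" using D(2) C(2) by linarith
  also have "\<dots> = dim F * (dim F + m - 1) + 2"
    unfolding Suc.prems(4) Suc.hyps(2)[symmetric] by (cases k; cases m) (simp_all add: algebra_simps)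
  finally show ?case using D(1,3) by auto
qed

text \<open>The bound is carried by dim (V \<inter> Ker Q): a step whose cost is only bounded by dim
  V - 1 can be compensated by a drop of this dimension. Terms are moved across the inequality to
  avoid subtraction.\<close>

lemma upper_Alt_odd:
  assumes "nondeg_on V" "max_singular V F" "nil_space (Alt_b scale b) V W" "dim V = 2 * dim F + 1"
  shows "\<exists>C. finite C \<and> card C + dim F \<le> dim F * dim F + dim (V \<inter> KerQ b) \<and> W \<subseteq> E.span C"
  using assms
proof (induction "dim F" arbitrary: V F W)
  case 0
  show ?case
    by (rule exI[of _ "{}"])
      (intro conjI nil_space_anisotropic[OF 0(3) 0(1)[symmetric] Alt_subset_Sym 0(4)]; simp add: 0(1)[symmetric])
next
  case (Suc k)
  have FQ: "F \<subseteq> V \<inter> KerQ b" using max_singular_isotropic[OF Suc.prems(2)] by (auto simp: KerQ_def)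
  have sF: "subspace F" using Suc.prems(2) by (simp add: max_singular_def)
  \<comment> \<open>The vector \<open>x\<close> is chosen differently in the two cases below, so the
    constants of the reduction enter as variables fixed by equations.\<close>
  have IH: "\<exists>D. finite D \<and> card D + k \<le> dim Wx + dim M + k * k + dim (V\<^sub>1 \<inter> KerQ b) \<and> W \<subseteq> E.span D"
    if "isotropic_pair scale Basis b V x y0" "x \<in> F"
    and defs: "Wx = nil_reduction.Wx x W" "M = nil_reduction.M scale b x y0 W"
      "V\<^sub>1 = isotropic_pair.V\<^sub>1 b V x y0" for x y0 Wx M V\<^sub>1
  proof -
    interpret isotropic_pair scale Basis b V x y0 by (rule that(1))
    interpret nil_reduction scale Basis b V x y0 "Alt_b scale b" W
      by unfold_locales (use Suc.prems(3) in auto)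
    note F1 = max_singular_V1[OF Suc.prems(2) that(2)]
    have k: "k = dim (F \<inter> V\<^sub>1)" using F1(2) Suc.hyps(2) defs(3) by simp
    then obtain C where C: "finite C" "card C + k \<le> k * k + dim (V\<^sub>1 \<inter> KerQ b)"
        "compress ` W\<^sub>0 \<subseteq> E.span C"
      using Suc.hyps(1)[OF k[unfolded defs] nondeg_V1 F1(1) nil_space_compress] dim_V1
        Suc.prems(4) Suc.hyps(2) defs(3) by auto
    obtain D where "finite D" "card D \<le> dim Wx + dim M + card C" "W \<subseteq> E.span D"
      using span_bound[OF C(1,3)] defs by blast
    then show ?thesis using C(2) by (intro exI[of _ D]) linarith
  qed
  show ?case
  proof (cases "\<exists>x\<in>F. \<exists>k\<in>V \<inter> KerQ b. b x k \<noteq> 0")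
    case True
    then obtain x z where xF: "x \<in> F" and z: "z \<in> V \<inter> KerQ b" "b x z \<noteq> 0" by blast
    then have "x \<noteq> 0" by auto
    then obtain y0 where pair: "isotropic_pair scale Basis b V x y0"
      using isotropic_pair_exists[OF Suc.prems(1)] max_singular_isotropic[OF Suc.prems(2) xF] by blast
    interpret isotropic_pair scale Basis b V x y0 by (rule pair)
    interpret nil_reduction scale Basis b V x y0 "Alt_b scale b" W
      by unfold_locales (use Suc.prems(3) in auto)
    obtain D where D: "finite D" "card D + k \<le> dim Wx + dim M + k * k + dim (V\<^sub>1 \<inter> KerQ b)"
        "W \<subseteq> E.span D"
      using IH[OF pair xF refl refl refl] by blast
    \<comment> \<open>Here \<open>x\<close> is outside the radical, and the loss of two dimensions
      of Ker Q pays for the weaker \<open>count_Sym\<close>.\<close>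
    have "card D + dim F \<le> dim F * dim F + dim (V \<inter> KerQ b)"
      using D(2) count_Sym dim_KerQ_V1[OF z] Suc.prems(4) unfolding Suc.hyps(2)[symmetric] by simp
    then show ?thesis using D(1,3) by blast
  next
    case False
    then have "V \<inter> KerQ b \<subseteq> V \<inter> KerQ b \<inter> orth b F" by (auto simp: orth_def)
    \<comment> \<open>\<open>F\<close> is orthogonal to all isotropic vectors of \<open>V\<close>,
      so maximality puts them all in \<open>F\<close>.\<close>
    then have KF: "V \<inter> KerQ b \<subseteq> F" using Suc.prems(2) unfolding max_singular_def by blast
    obtain x where xF: "x \<in> F" "x \<noteq> 0" using exists_nonzero[OF Suc.hyps(2)] by blast
    then obtain y0 where pair: "isotropic_pair scale Basis b V x y0"
      using isotropic_pair_exists[OF Suc.prems(1)] max_singular_isotropic[OF Suc.prems(2) xF(1)] by blast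
    interpret isotropic_pair scale Basis b V x y0 by (rule pair)
    interpret nil_reduction scale Basis b V x y0 "Alt_b scale b" W
      by unfold_locales (use Suc.prems(3) in auto)
    note F1 = max_singular_V1[OF Suc.prems(2) xF(1)]
    obtain D where D: "finite D" "card D + k \<le> dim Wx + dim M + k * k + dim (V\<^sub>1 \<inter> KerQ b)"
        "W \<subseteq> E.span D"
      using IH[OF pair xF(1) refl refl refl] by blast
    have TS: "\<And>f. f \<in> F \<Longrightarrow> b x f = 0"
      using Suc.prems(2) xF(1) by (simp add: max_singular_def totally_singular_def)
    \<comment> \<open>Hence Q vanishes on \<open>Wx\<close>, and the count dim V - 2 holds although
      \<open>count_Alt\<close> does not cover this dimension.\<close>
    have "u x \<in> F" if "u \<in> W" for u
      using that W_in_V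
      by (intro nilpotent_image_in_singular[OF W_Sym W_nilpotent _ sF KF TS, of u]) auto
    then have "z \<in> F" if "z \<in> Wx" for z using that by (auto simp: Wx_def)
    then have "dim Wx + dim M + 2 \<le> dim V"
      using max_singular_isotropic[OF Suc.prems(2)] b_x_Wx_Alt b_y0_M_Alt x_notin_M_Alt
      by (intro Q_Wx_zero_count) auto
    moreover have "dim (V\<^sub>1 \<inter> KerQ b) \<le> dim (F \<inter> V\<^sub>1)"
      using KF V1_subset by (intro dim_subset) auto
    moreover have "dim F \<le> dim (V \<inter> KerQ b)" using FQ by (rule dim_subset)
    ultimately have "card D + dim F \<le> dim F * dim F + dim (V \<inter> KerQ b)"
      using D(2) Suc.prems(4) F1(2) unfolding Suc.hyps(2)[symmetric] by simp
    then show ?thesis using D(1,3) by blast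
  qed
qed

section \<open>Construction of extremal spaces\<close>

text \<open>Evaluation at \<open>z\<close> kills \<open>B\<close> and maps the \<open>g d\<close> to
  independent vectors, so no \<open>g d\<close> depends on the others.\<close>

lemma independent_Un_eval:
  assumes B: "E.independent B" "finite B" "\<And>u. u \<in> B \<Longrightarrow> u z = 0"
    and D: "independent D" and g: "\<And>d. d \<in> D \<Longrightarrow> g d z = d"
  shows "E.independent (B \<union> g ` D) \<and> card (B \<union> g ` D) = card B + card D"
proof -
  interpret EV: vector_space_pair "end_scale scale" scale
    by (rule vector_space_pair.intro[OF E.vector_space_axioms vector_space_axioms])
  have "finite D" using D by (rule finiteI_independent)
  then show ?thesis using D g
  proof (induction D)
    case empty
    show ?case using B(1) by simp
  next
    case (insert d D)
    have D: "independent D" "d \<notin> span D" using insert.prems(1) insert.hyps(2) by (simp_all add: independent_insert)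
    note IH = conjunct1[OF insert.IH[OF D(1) insert.prems(2)[OF insertI2]]]
      conjunct2[OF insert.IH[OF D(1) insert.prems(2)[OF insertI2]]]
    have gd: "g d \<notin> E.span (B \<union> g ` D)"
    proof
      assume "g d \<in> E.span (B \<union> g ` D)"
      then have "g d z \<in> (\<lambda>u. u z) ` E.span (B \<union> g ` D)" by (rule imageI)
      then have "g d z \<in> span ((\<lambda>u. u z) ` (B \<union> g ` D))"
        unfolding EV.linear_span_image[OF linear_eval[of z]] .
      moreover have "span ((\<lambda>u. u z) ` (B \<union> g ` D)) \<subseteq> span D"
      proof (intro span_minimal[OF _ subspace_span] image_subsetI)
        fix u assume "u \<in> B \<union> g ` D"
        then show "u z \<in> span D"
        proof
          assume "u \<in> B"
          then show ?thesis using B(3)[of u] span_zero by metis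
        next
          assume "u \<in> g ` D"
          then obtain e where "e \<in> D" "u = g e" by blast
          then show ?thesis using insert.prems(2)[of e] span_base[of e D] by simp
        qed
      qed
      ultimately have "d \<in> span D"
        unfolding insert.prems(2)[OF insertI1] by (rule subsetD[rotated])
      then show False using D(2) by blast
    qed
    have "g d \<notin> B \<union> g ` D" using gd E.span_base[of "g d"] by (rule contrapos_nn)
    moreover have "finite (B \<union> g ` D)" using insert.hyps(1) B(2) by simp
    moreover have "B \<union> g ` insert d D = insert (g d) (B \<union> g ` D)" by simp
    ultimately show ?case
      using E.independent_insertI[OF gd IH(1)] IH(2) insert.hyps(1,2) by simp
  qed
qed

text \<open>The generalized kernel of \<open>u\<close>. Nilpotency is proved below by putting
  vectors in it one after another, using that z belongs to it as soon as u z does.\<close>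

definition nil_vectors :: "('v \<Rightarrow> 'v) \<Rightarrow> 'v set" where
  "nil_vectors u = {z. \<exists>k. (u ^^ k) z = 0}"

lemma nil_vectors_step: "u z \<in> nil_vectors u \<Longrightarrow> z \<in> nil_vectors u"
proof -
  assume "u z \<in> nil_vectors u"
  then obtain k where "(u ^^ k) (u z) = 0" by (auto simp: nil_vectors_def)
  then have "(u ^^ Suc k) z = 0" by (simp add: funpow_swap1)
  then show ?thesis unfolding nil_vectors_def by blast
qed

lemma subspace_nil_vectors:
  assumes u: "Vector_Spaces.linear scale scale u"
  shows "subspace (nil_vectors u)"
proof -
  interpret u: Vector_Spaces.linear scale scale u by (rule u)
  have pow_add: "(u ^^ i) (z + w) = (u ^^ i) z + (u ^^ i) w" for i z w
    by (induction i) (simp_all add: u.add)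
  have pow_scale: "(u ^^ i) (c *s z) = c *s (u ^^ i) z" for i z c
    by (induction i) (simp_all add: u.scale)
  show ?thesis
  proof (rule subspaceI)
    show "0 \<in> nil_vectors u" unfolding nil_vectors_def by (auto intro: exI[of _ 0])
  next
    fix z w assume "z \<in> nil_vectors u" "w \<in> nil_vectors u"
    then obtain i j where "(u ^^ i) z = 0" "(u ^^ j) w = 0" by (auto simp: nil_vectors_def)
    then have "(u ^^ (i + j)) z = 0" "(u ^^ (i + j)) w = 0"
      using funpow_zero_mono[of i u z "i + j"] funpow_zero_mono[of j u w "i + j"] u.zero by simp_all
    then have "(u ^^ (i + j)) (z + w) = 0" by (simp add: pow_add)
    then show "z + w \<in> nil_vectors u" unfolding nil_vectors_def by blast
  next
    fix c z assume "z \<in> nil_vectors u"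
    then obtain i where "(u ^^ i) z = 0" by (auto simp: nil_vectors_def)
    then have "(u ^^ i) (c *s z) = 0" by (simp add: pow_scale)
    then show "c *s z \<in> nil_vectors u" unfolding nil_vectors_def by blast
  qed
qed

lemma Sym_vanishes:
  assumes u: "u \<in> Sym_b scale b" "range u \<subseteq> V" and w: "\<And>z. z \<in> V \<Longrightarrow> b w z = 0"
  shows "u w = 0"
proof -
  have "b z (u w) = 0" for z using Sym_adjoint[OF u(1), of z w] w[of "u z"] u(2) by auto
  then have "b (u w) z = 0" for z using b_comm[of "u w" z] by simp
  then show ?thesis using nd unfolding nondegenerate_def by blast
qed

text \<open>A lower bound on the dimension, witnessed by a finite independent set that can be
  enlarged step by step.\<close>

definition has_nil_space :: "('v \<Rightarrow> 'v) set \<Rightarrow> 'v set \<Rightarrow> nat \<Rightarrow> bool" where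
  "has_nil_space S V k \<longleftrightarrow>
    (\<exists>W B. nil_space S V W \<and> B \<subseteq> W \<and> E.independent B \<and> finite B \<and> k \<le> card B)"

lemma has_nil_space_0:
  assumes "S = Sym_b scale b \<or> S = Alt_b scale b" "subspace V"
  shows "has_nil_space S V 0"
proof -
  have "E.subspace S" using assms(1) subspace_Sym subspace_Alt by auto
  then have "0 \<in> S" by (rule E.subspace_0)
  moreover have "nilpotent_endo (0 :: 'v \<Rightarrow> 'v)"
    unfolding nilpotent_endo_def by (rule exI[of _ 1]) (simp add: fun_eq_iff)
  ultimately have "nil_space S V {0}"
    using subspace_0[OF assms(2)] by (simp add: nil_space_def image_subset_iff)
  then show ?thesis unfolding has_nil_space_def
    by (intro exI[of _ "{0}"] exI[of _ "{}"]) (simp add: E.independent_empty)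
qed

lemma has_nil_space_extend:
  assumes W\<^sub>1: "nil_space S\<^sub>1 V\<^sub>1 W\<^sub>1" "B \<subseteq> W\<^sub>1" "E.independent B" "finite B" "k \<le> card B"
    and z: "\<And>u. u \<in> W\<^sub>1 \<Longrightarrow> u z = 0"
    and W: "nil_space S V W" "W\<^sub>1 \<subseteq> W"
    and D: "independent D" "\<And>d. d \<in> D \<Longrightarrow> g d \<in> W \<and> g d z = d"
  shows "has_nil_space S V (k + card D)"
proof -
  have "E.independent (B \<union> g ` D) \<and> card (B \<union> g ` D) = card B + card D"
    by (rule independent_Un_eval[where z = z, OF W\<^sub>1(3,4) _ D(1)]) (use z W\<^sub>1(2) D(2) in blast)+
  moreover have "B \<union> g ` D \<subseteq> W" using W\<^sub>1(2) W(2) D(2) by auto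
  moreover have "finite (B \<union> g ` D)" using W\<^sub>1(4) finiteI_independent[OF D(1)] by simp
  ultimately show ?thesis unfolding has_nil_space_def
    by (intro exI[of _ W] exI[of _ "B \<union> g ` D"]) (simp add: W(1) W\<^sub>1(5))
qed

end

section \<open>Lifting nilpotent spaces from the reduced space\<close>

context isotropic_pair
begin

text \<open>The shape found in \<open>K_form\<close>. The parameter \<open>a\<close> provides the
  additional dimension of the symmetric case; alternating maps require a = 0.\<close>

definition pert :: "'v \<Rightarrow> 'a \<Rightarrow> 'v \<Rightarrow> 'v" where
  "pert y a = (\<lambda>z. (b y z + a * b x z) *s x + b x z *s y)"

lemma pert_add: "pert y a + pert y' a' = pert (y + y') (a + a')"
  by (simp add: pert_def fun_eq_iff algebra_simps)

lemma pert_scale: "end_scale scale c (pert y a) = pert (c *s y) (c * a)"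
  by (simp add: pert_def end_scale_apply fun_eq_iff algebra_simps)

lemma pert_0: "pert 0 0 = 0"
  by (simp add: pert_def fun_eq_iff)

lemma pert_Sym: "pert y a \<in> Sym_b scale b"
  unfolding Sym_b_def is_endo_def
proof (intro CollectI conjI allI)
  show "Vector_Spaces.linear scale scale (pert y a)"
    by (rule linearI) (simp_all add: pert_def algebra_simps)
  show "b z (pert y a w) = b w (pert y a z)" for z w
    unfolding pert_def
    by (simp add: b_comm[of z x] b_comm[of z y] b_comm[of w x] b_comm[of w y] algebra_simps)
qed

lemma pert_Alt: "pert y 0 \<in> Alt_b scale b"
proof -
  have "b z (pert y 0 z) = 0" for z
    by (simp add: pert_def b_comm[of z x] b_comm[of z y] mult.commute add_self)
  then show ?thesis using pert_Sym[of y 0] by (simp add: Alt_b_def Sym_b_def)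
qed

text \<open>The generalized kernel of w = u + pert y a absorbs first \<open>x\<close>, since w x =
  0, then \<open>V\<^sub>1\<close>, where w differs from u by a multiple of \<open>x\<close>, and
  last \<open>y\<^sub>0\<close>, since \<open>w y\<^sub>0 = a *s x + y\<close>.\<close>

lemma nilpotent_lift:
  assumes u: "u \<in> Sym_b scale b" "range u \<subseteq> V\<^sub>1" "nilpotent_endo u" and y: "y \<in> V\<^sub>1"
  shows "nilpotent_endo (u + pert y a)"
proof -
  define w where "w = u + pert y a"
  have w: "w z = u z + ((b y z + a * b x z) *s x + b x z *s y)" for z
    by (simp add: w_def pert_def)
  have "w \<in> Sym_b scale b" unfolding w_def using u(1) pert_Sym by (rule E.subspace_add[OF subspace_Sym])
  then have lin: "Vector_Spaces.linear scale scale w" by (rule Sym_linear)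
  note sN = subspace_nil_vectors[OF lin]
  have yx: "b y x = 0" "b y y\<^sub>0 = 0" using y b_comm[of y x] b_comm[of y y\<^sub>0] by (auto simp: V\<^sub>1_def)
  have "u x = 0" by (rule Sym_vanishes[OF u(1,2)]) (simp add: V\<^sub>1_def)
  then have "w x = 0" by (simp add: w x(2) yx)
  then have "w x \<in> nil_vectors w" using subspace_0[OF sN] by simp
  then have xN: "x \<in> nil_vectors w" by (rule nil_vectors_step)
  have V1N: "h \<in> nil_vectors w" if "h \<in> V\<^sub>1" "(u ^^ n) h = 0" for h n
    using that
  proof (induction n arbitrary: h)
    case 0
    then show ?case using subspace_0[OF sN] by simp
  next
    case (Suc n)
    have "u h \<in> nil_vectors w" using Suc u(2) by (intro Suc.IH) (auto simp: funpow_swap1)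
    moreover have "w h = u h + b y h *s x" using Suc.prems(1) by (simp add: w V\<^sub>1_def)
    ultimately have "w h \<in> nil_vectors w" using xN subspace_add[OF sN] subspace_scale[OF sN] by simp
    then show ?case by (rule nil_vectors_step)
  qed
  obtain n where n: "u ^^ n = (\<lambda>_. 0)" using u(3) by (auto simp: nilpotent_endo_def)
  have V1: "h \<in> nil_vectors w" if "h \<in> V\<^sub>1" for h using V1N[OF that, of n] n by simp
  have "u y\<^sub>0 = 0" by (rule Sym_vanishes[OF u(1,2)]) (simp add: V\<^sub>1_def)
  then have "w y\<^sub>0 = a *s x + y" by (simp add: w yx y0(2))
  then have "w y\<^sub>0 \<in> nil_vectors w"
    using xN V1[OF y] subspace_add[OF sN] subspace_scale[OF sN] by simp
  then have y0N: "y\<^sub>0 \<in> nil_vectors w" by (rule nil_vectors_step)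
  have VN: "z \<in> nil_vectors w" if "z \<in> V" for z
  proof (subst decompose[of z])
    show "(b y\<^sub>0 z - b y\<^sub>0 y\<^sub>0 * b x z) *s x + b x z *s y\<^sub>0 + proj z \<in> nil_vectors w"
      using xN y0N V1[OF proj_in_V1[OF that]] by (intro subspace_add[OF sN] subspace_scale[OF sN])
  qed
  have "w z \<in> V" for z
    unfolding w using u(2) V1_subset y x(1)
    by (intro subspace_add[OF subspace_V] subspace_scale[OF subspace_V]) auto
  then have "z \<in> nil_vectors w" for z using VN nil_vectors_step by blast
  then have "nilpotent_endo w" using nilpotentI_local[OF lin] by (auto simp: nil_vectors_def)
  then show ?thesis by (simp add: w_def)
qed

text \<open>The set \<open>A\<close> of admissible parameters lets one argument serve both kinds of
  endomorphisms.\<close>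

lemma nil_space_lift:
  assumes SA: "S = Sym_b scale b \<and> A = UNIV \<or> S = Alt_b scale b \<and> A = {0}"
    and W\<^sub>1: "nil_space S V\<^sub>1 W\<^sub>1"
  shows "nil_space S V {u + pert y a |u y a. u \<in> W\<^sub>1 \<and> y \<in> V\<^sub>1 \<and> a \<in> A}" (is "nil_space S V ?W")
  unfolding nil_space_def
proof (intro conjI ballI)
  have sS: "E.subspace S" and SS: "S \<subseteq> Sym_b scale b"
    using SA subspace_Sym subspace_Alt Alt_subset_Sym by auto
  have A: "0 \<in> A" "\<And>a a'. \<lbrakk>a \<in> A; a' \<in> A\<rbrakk> \<Longrightarrow> a + a' \<in> A" "\<And>c a. a \<in> A \<Longrightarrow> c * a \<in> A"
    using SA by auto
  have pS: "pert y a \<in> S" if "a \<in> A" for y a using SA that pert_Sym pert_Alt by auto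
  have sW: "E.subspace W\<^sub>1" using W\<^sub>1 by (simp add: nil_space_def)
  show "E.subspace ?W"
  proof (rule E.subspaceI)
    show "0 \<in> ?W" using E.subspace_0[OF sW] subspace_0[OF subspace_V1] A(1) pert_0 by force
  next
    fix v w assume "v \<in> ?W" "w \<in> ?W"
    then obtain u y a u' y' a' where *: "v = u + pert y a" "w = u' + pert y' a'"
      "u \<in> W\<^sub>1" "y \<in> V\<^sub>1" "a \<in> A" "u' \<in> W\<^sub>1" "y' \<in> V\<^sub>1" "a' \<in> A" by blast
    have "v + w = (u + u') + pert (y + y') (a + a')"
      unfolding * pert_add[symmetric] by (simp add: add_ac)
    then show "v + w \<in> ?W"
      using * E.subspace_add[OF sW] subspace_add[OF subspace_V1] A(2) by blast
  next
    fix c v assume "v \<in> ?W"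
    then obtain u y a where *: "v = u + pert y a" "u \<in> W\<^sub>1" "y \<in> V\<^sub>1" "a \<in> A" by blast
    have "end_scale scale c v = end_scale scale c u + pert (c *s y) (c * a)"
      unfolding *(1) pert_scale[symmetric] by (rule E.scale_right_distrib)
    then show "end_scale scale c v \<in> ?W"
      using * E.subspace_scale[OF sW] subspace_scale[OF subspace_V1] A(3) by blast
  qed
  fix v assume "v \<in> ?W"
  then obtain u y a where *: "v = u + pert y a" "u \<in> W\<^sub>1" "y \<in> V\<^sub>1" "a \<in> A" by blast
  have u: "u \<in> S" "range u \<subseteq> V\<^sub>1" "nilpotent_endo u" using W\<^sub>1 *(2) by (auto simp: nil_space_def)
  show "v \<in> S" unfolding *(1) using u(1) pS[OF *(4)] by (rule E.subspace_add[OF sS])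
  have "u z \<in> V" for z using u(2) V1_subset by auto
  then have "v z \<in> V" for z
    using x(1) V1_subset *(3) unfolding *(1) plus_fun_apply pert_def
    by (intro subspace_add[OF subspace_V] subspace_scale[OF subspace_V]) auto
  then show "range v \<subseteq> V" by auto
  show "nilpotent_endo v"
    unfolding *(1) using u SS *(3) by (intro nilpotent_lift) auto
qed

text \<open>Lifted maps from \<open>W\<^sub>1\<close> vanish at \<open>y\<^sub>0\<close>, while
  \<open>pert d 0\<close> takes the value d there: a basis of \<open>V\<^sub>1\<close> gives as many
  new independent elements. In the symmetric case \<open>pert 0 1\<close>, with value
  \<open>x\<close>, is one more.\<close>

lemma has_nil_space_step:
  assumes S: "S = Sym_b scale b \<or> S = Alt_b scale b" and V1: "has_nil_space S V\<^sub>1 k"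
  shows "has_nil_space S V (k + dim V\<^sub>1)"
    and "S = Sym_b scale b \<Longrightarrow> has_nil_space S V (k + dim V\<^sub>1 + 1)"
proof -
  obtain W\<^sub>1 B where W1: "nil_space S V\<^sub>1 W\<^sub>1" "B \<subseteq> W\<^sub>1" "E.independent B" "finite B" "k \<le> card B"
    using V1 unfolding has_nil_space_def by blast
  have SS: "S \<subseteq> Sym_b scale b" using S Alt_subset_Sym by auto
  have uy0: "u y\<^sub>0 = 0" if "u \<in> W\<^sub>1" for u
    using that W1(1) SS by (intro Sym_vanishes[of u V\<^sub>1]) (auto simp: nil_space_def V\<^sub>1_def)
  have py0: "pert d 0 y\<^sub>0 = d" if "d \<in> V\<^sub>1" for d
    using that y0(2) b_comm[of d y\<^sub>0] by (simp add: pert_def V\<^sub>1_def)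
  obtain D where D: "D \<subseteq> V\<^sub>1" "independent D" "V\<^sub>1 \<subseteq> span D" "card D = dim V\<^sub>1"
    using basis_exists by blast
  define A :: "'a set" where "A = (if S = Sym_b scale b then UNIV else {0})"
  have SA: "S = Sym_b scale b \<and> A = UNIV \<or> S = Alt_b scale b \<and> A = {0}" using S by (auto simp: A_def)
  define W where "W = {u + pert y a |u y a. u \<in> W\<^sub>1 \<and> y \<in> V\<^sub>1 \<and> a \<in> A}"
  have nilW: "nil_space S V W" unfolding W_def by (rule nil_space_lift[OF SA W1(1)])
  have "0 \<in> A" using SA by auto
  have "0 \<in> W\<^sub>1" using W1(1) E.subspace_0 by (auto simp: nil_space_def)
  have W1W: "W\<^sub>1 \<subseteq> W"
    unfolding W_def using \<open>0 \<in> A\<close> subspace_0[OF subspace_V1] pert_0 by force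
  have pW: "pert y a \<in> W" if "y \<in> V\<^sub>1" "a \<in> A" for y a
    unfolding W_def using \<open>0 \<in> W\<^sub>1\<close> that by force
  have "has_nil_space S V (k + card D)"
    by (rule has_nil_space_extend[OF W1 uy0 nilW W1W D(2), where g = "\<lambda>d. pert d 0"])
      (use pW py0 D(1) \<open>0 \<in> A\<close> in auto)
  then show "has_nil_space S V (k + dim V\<^sub>1)" using D(4) by simp
  assume Sym: "S = Sym_b scale b"
  have xD: "x \<notin> span D"
    using span_minimal[OF D(1) subspace_V1] b_y0_x by (auto simp: V\<^sub>1_def)
  then have indep: "independent (insert x D)" using D(2) by (rule independent_insertI)
  have "x \<notin> D" using xD span_base by blast
  then have card: "card (insert x D) = dim V\<^sub>1 + 1" using finiteI_independent[OF D(2)] D(4) by simp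
  have "pert 0 1 y\<^sub>0 = x" using y0(2) by (simp add: pert_def)
  then have "has_nil_space S V (k + card (insert x D))"
    by (intro has_nil_space_extend[OF W1 uy0 nilW W1W indep, where g = "\<lambda>d. if d = x then pert 0 1 else pert d 0"])
      (use pW py0 D(1) SA Sym subspace_0[OF subspace_V1] \<open>0 \<in> A\<close> in \<open>auto simp: A_def\<close>)
  then show "has_nil_space S V (k + dim V\<^sub>1 + 1)" using card by (simp add: add.assoc)
qed

end

section \<open>Extremal spaces by induction\<close>

context nondegenerate_form
begin

lemma lower_Sym:
  assumes "nondeg_on V" "max_singular V F" "dim V = 2 * dim F + m"
  shows "has_nil_space (Sym_b scale b) V (dim F * (dim F + m))"
  using assms
proof (induction "dim F" arbitrary: V F)
  case 0
  have "subspace V" using 0(2) by (simp add: nondeg_on_def)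
  then show ?case using has_nil_space_0[of "Sym_b scale b" V] by (simp add: 0(1)[symmetric])
next
  case (Suc k)
  obtain x where xF: "x \<in> F" "x \<noteq> 0" using exists_nonzero[OF Suc.hyps(2)] by blast
  then obtain y0 where "isotropic_pair scale Basis b V x y0"
    using isotropic_pair_exists[OF Suc.prems(1)] max_singular_isotropic[OF Suc.prems(2) xF(1)] by blast
  then interpret isotropic_pair scale Basis b V x y0 .
  note F1 = max_singular_V1[OF Suc.prems(2) xF(1)]
  have k: "k = dim (F \<inter> V\<^sub>1)" using F1(2) Suc.hyps(2) by simp
  have d: "dim V\<^sub>1 = 2 * dim (F \<inter> V\<^sub>1) + m" using dim_V1 Suc.prems(3) Suc.hyps(2) k by simp
  have "has_nil_space (Sym_b scale b) V\<^sub>1 (k * (k + m))"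
    using Suc.hyps(1)[OF k nondeg_V1 F1(1) d] k by simp
  then have "has_nil_space (Sym_b scale b) V (k * (k + m) + dim V\<^sub>1 + 1)"
    by (intro has_nil_space_step(2)) simp_all
  moreover have "k * (k + m) + dim V\<^sub>1 + 1 = dim F * (dim F + m)"
    unfolding d k[symmetric] Suc.hyps(2)[symmetric] by (simp add: algebra_simps)
  ultimately show ?case by simp
qed

text \<open>Each step gains \<open>dim V\<^sub>1\<close>, that is dim V - 2. The case m = 0 also
  serves as the symplectic ingredient of \<open>lower_Alt_odd\<close>.\<close>

lemma lower_Alt:
  assumes "nondeg_on V" "max_singular V F" "dim V = 2 * dim F + m"
  shows "has_nil_space (Alt_b scale b) V (dim F * (dim F + m - 1))"
  using assms
proof (induction "dim F" arbitrary: V F)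
  case 0
  have "subspace V" using 0(2) by (simp add: nondeg_on_def)
  then show ?case using has_nil_space_0[of "Alt_b scale b" V] by (simp add: 0(1)[symmetric])
next
  case (Suc k)
  obtain x where xF: "x \<in> F" "x \<noteq> 0" using exists_nonzero[OF Suc.hyps(2)] by blast
  then obtain y0 where "isotropic_pair scale Basis b V x y0"
    using isotropic_pair_exists[OF Suc.prems(1)] max_singular_isotropic[OF Suc.prems(2) xF(1)] by blast
  then interpret isotropic_pair scale Basis b V x y0 .
  note F1 = max_singular_V1[OF Suc.prems(2) xF(1)]
  have k: "k = dim (F \<inter> V\<^sub>1)" using F1(2) Suc.hyps(2) by simp
  have d: "dim V\<^sub>1 = 2 * dim (F \<inter> V\<^sub>1) + m" using dim_V1 Suc.prems(3) Suc.hyps(2) k by simp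
  have "has_nil_space (Alt_b scale b) V\<^sub>1 (k * (k + m - 1))"
    using Suc.hyps(1)[OF k nondeg_V1 F1(1) d] k by simp
  then have "has_nil_space (Alt_b scale b) V (k * (k + m - 1) + dim V\<^sub>1)"
    by (intro has_nil_space_step(1)) simp_all
  moreover have "k * (k + m - 1) + dim V\<^sub>1 = dim F * (dim F + m - 1)"
    unfolding d k[symmetric] Suc.hyps(2)[symmetric] by (cases k; cases m) (simp_all add: algebra_simps)
  ultimately show ?case by simp
qed

text \<open>\<open>V\<close> is the orthogonal sum of the line of \<open>c\<close> and of
  \<open>V\<^sub>0\<close>, on which \<open>b\<close> is alternating. The maps
  \<open>wedge w\<close> stay nilpotent after adding u because w is orthogonal to all its iterates
  under u; the generalized kernel then absorbs w, \<open>c\<close>, \<open>V\<^sub>0\<close> and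
  \<open>V\<close> in this order.\<close>

lemma lower_Alt_symplectic_sum:
  assumes V: "subspace V" and c: "c \<in> V" "b c c \<noteq> 0"
    and V0: "V\<^sub>0 = {z \<in> V. b c z = 0}" "V\<^sub>0 \<subseteq> KerQ b"
    and k: "has_nil_space (Alt_b scale b) V\<^sub>0 k"
  shows "has_nil_space (Alt_b scale b) V (k + dim V\<^sub>0)"
proof -
  obtain W\<^sub>0 B where W0: "nil_space (Alt_b scale b) V\<^sub>0 W\<^sub>0" "B \<subseteq> W\<^sub>0" "E.independent B" "finite B" "k \<le> card B"
    using k unfolding has_nil_space_def by blast
  have sV0: "subspace V\<^sub>0" unfolding V0(1) by (rule subspace_kernel_functional[OF V linear_b])
  have sW0: "E.subspace W\<^sub>0" using W0(1) by (simp add: nil_space_def)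
  have W0D: "u \<in> Alt_b scale b" "u \<in> Sym_b scale b" "range u \<subseteq> V\<^sub>0" "nilpotent_endo u" if "u \<in> W\<^sub>0" for u
    using W0(1) that Alt_subset_Sym unfolding nil_space_def by blast+
  have uc: "u c = 0" if "u \<in> W\<^sub>0" for u
    by (rule Sym_vanishes[OF W0D(2,3)[OF that]]) (simp add: V0(1))
  define wedge where "wedge w = (\<lambda>z. b w z *s c + b c z *s w)" for w
  have wedge_Alt: "wedge w \<in> Alt_b scale b" for w
  proof -
    have "Vector_Spaces.linear scale scale (wedge w)"
      by (rule linearI) (simp_all add: wedge_def algebra_simps)
    moreover have "b z (wedge w z) = 0" for z
      by (simp add: wedge_def b_comm[of z c] b_comm[of z w] mult.commute add_self)
    ultimately show ?thesis by (simp add: Alt_b_def is_endo_def)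
  qed
  have wedge_0: "wedge 0 = 0" by (simp add: wedge_def fun_eq_iff)
  have wedge_add: "wedge w + wedge w' = wedge (w + w')" for w w'
    by (simp add: wedge_def fun_eq_iff algebra_simps)
  have wedge_scale: "end_scale scale a (wedge w) = wedge (a *s w)" for a w
    by (simp add: wedge_def fun_eq_iff end_scale_apply algebra_simps)
  define W where "W = {u + wedge w |u w. u \<in> W\<^sub>0 \<and> w \<in> V\<^sub>0}"
  have nil: "nilpotent_endo (u + wedge w)" if u: "u \<in> W\<^sub>0" and w: "w \<in> V\<^sub>0" for u w
  proof -
    define v where "v = u + wedge w"
    have v: "v z = u z + (b w z *s c + b c z *s w)" for z by (simp add: v_def wedge_def)
    have "v \<in> Alt_b scale b" unfolding v_def
      using W0D(1)[OF u] wedge_Alt by (rule E.subspace_add[OF subspace_Alt])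
    then have lin: "Vector_Spaces.linear scale scale v" using Alt_subset_Sym Sym_linear by blast
    interpret v: Vector_Spaces.linear scale scale v by (rule lin)
    note sN = subspace_nil_vectors[OF lin]
    obtain n where n: "u ^^ n = (\<lambda>_. 0)" using W0D(4)[OF u] by (auto simp: nilpotent_endo_def)
    have uV0: "u z \<in> V\<^sub>0" for z using W0D(3)[OF u] by auto
    have powV0: "(u ^^ j) w \<in> V\<^sub>0" for j using w uV0 by (cases j) simp_all
    have Q0: "b z z = 0" if "z \<in> V\<^sub>0" for z using V0(2) that by (auto simp: KerQ_def)
    \<comment> \<open>For even j this is the value of Q at the iterate of order j/2, zero on
      \<open>V\<^sub>0\<close>; for odd j it vanishes because u is alternating.\<close>
    have bw: "b w ((u ^^ j) w) = 0" for j
    proof -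
      have adj: "b w ((u ^^ (i + l)) w) = b ((u ^^ i) w) ((u ^^ l) w)" for i l
        using Sym_funpow_adjoint[OF W0D(2)[OF u], of i w "(u ^^ l) w"] by (simp add: funpow_add)
      have "b z (u z) = 0" for z using W0D(1)[OF u] by (simp add: Alt_b_def)
      then have "b w ((u ^^ (i + Suc i)) w) = 0" for i unfolding adj by simp
      moreover have "b w ((u ^^ (i + i)) w) = 0" for i unfolding adj using powV0 by (rule Q0)
      moreover obtain i where "j = i + i \<or> j = i + Suc i"
        by (metis evenE oddE mult_2 add_Suc_right Suc_eq_plus1)
      ultimately show ?thesis by metis
    qed
    have "b w c = 0" "b c w = 0" using w b_comm[of w c] by (auto simp: V0(1))
    then have "v c = b c c *s w" by (simp add: v uc[OF u])
    moreover have vpow: "(v ^^ j) w = (u ^^ j) w" for j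
    proof (induction j)
      case (Suc j)
      have "b c ((u ^^ j) w) = 0" using powV0[of j] by (simp add: V0(1))
      then show ?case using Suc v[of "(u ^^ j) w"] bw[of j] by simp
    qed simp
    have "w \<in> nil_vectors v" unfolding nil_vectors_def using vpow[of n] n by auto
    ultimately have "v c \<in> nil_vectors v" using subspace_scale[OF sN] by simp
    then have cN: "c \<in> nil_vectors v" by (rule nil_vectors_step)
    have V0N: "h \<in> nil_vectors v" if "h \<in> V\<^sub>0" "(u ^^ i) h = 0" for h i
      using that
    proof (induction i arbitrary: h)
      case 0
      then show ?case using subspace_0[OF sN] by simp
    next
      case (Suc i)
      have "u h \<in> nil_vectors v" using Suc uV0 by (intro Suc.IH) (auto simp: funpow_swap1)
      moreover have "v h = u h + b w h *s c" using Suc.prems(1) by (simp add: v V0(1))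
      ultimately have "v h \<in> nil_vectors v" using cN subspace_add[OF sN] subspace_scale[OF sN] by simp
      then show ?case by (rule nil_vectors_step)
    qed
    have VN: "z \<in> nil_vectors v" if z: "z \<in> V" for z
    proof -
      define h where "h = z - (b c z / b c c) *s c"
      have "h \<in> V\<^sub>0"
        unfolding h_def V0(1) using z c by (simp add: subspace_diff[OF V] subspace_scale[OF V])
      then have "h \<in> nil_vectors v" using V0N[of h n] n by simp
      then have "h + (b c z / b c c) *s c \<in> nil_vectors v"
        using cN by (intro subspace_add[OF sN] subspace_scale[OF sN])
      then show ?thesis by (simp add: h_def)
    qed
    have "v z \<in> V" for z
      unfolding v using uV0 w c(1) V0(1)
      by (intro subspace_add[OF V] subspace_scale[OF V]) auto
    then have "z \<in> nil_vectors v" for z using VN nil_vectors_step by blast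
    then have "nilpotent_endo v" using nilpotentI_local[OF lin] by (auto simp: nil_vectors_def)
    then show ?thesis by (simp add: v_def)
  qed
  have nilW: "nil_space (Alt_b scale b) V W"
    unfolding nil_space_def
  proof (intro conjI ballI)
    show "E.subspace W"
    proof (rule E.subspaceI)
      show "0 \<in> W" unfolding W_def using E.subspace_0[OF sW0] subspace_0[OF sV0] wedge_0 by force
    next
      fix v v' assume "v \<in> W" "v' \<in> W"
      then obtain u w u' w' where *: "v = u + wedge w" "v' = u' + wedge w'"
        "u \<in> W\<^sub>0" "w \<in> V\<^sub>0" "u' \<in> W\<^sub>0" "w' \<in> V\<^sub>0" unfolding W_def by blast
      have "v + v' = (u + u') + wedge (w + w')"
        unfolding * wedge_add[symmetric] by (simp add: add_ac)
      then show "v + v' \<in> W"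
        unfolding W_def using * E.subspace_add[OF sW0] subspace_add[OF sV0] by blast
    next
      fix a v assume "v \<in> W"
      then obtain u w where *: "v = u + wedge w" "u \<in> W\<^sub>0" "w \<in> V\<^sub>0" unfolding W_def by blast
      have "end_scale scale a v = end_scale scale a u + wedge (a *s w)"
        unfolding *(1) wedge_scale[symmetric] by (rule E.scale_right_distrib)
      then show "end_scale scale a v \<in> W"
        unfolding W_def using * E.subspace_scale[OF sW0] subspace_scale[OF sV0] by blast
    qed
    fix v assume "v \<in> W"
    then obtain u w where *: "v = u + wedge w" "u \<in> W\<^sub>0" "w \<in> V\<^sub>0" unfolding W_def by blast
    show "v \<in> Alt_b scale b" unfolding *(1)
      using W0D(1)[OF *(2)] wedge_Alt by (rule E.subspace_add[OF subspace_Alt])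
    have "u z \<in> V" for z using W0D(3)[OF *(2)] V0(1) by auto
    then have "v z \<in> V" for z
      using c(1) *(3) V0(1) unfolding *(1) plus_fun_apply wedge_def
      by (intro subspace_add[OF V] subspace_scale[OF V]) auto
    then show "range v \<subseteq> V" by auto
    show "nilpotent_endo v" unfolding *(1) by (rule nil[OF *(2,3)])
  qed
  have W0W: "W\<^sub>0 \<subseteq> W" unfolding W_def using subspace_0[OF sV0] wedge_0 by force
  have wW: "wedge w \<in> W" if "w \<in> V\<^sub>0" for w
    unfolding W_def using E.subspace_0[OF sW0] that by force
  obtain D where D: "D \<subseteq> V\<^sub>0" "independent D" "V\<^sub>0 \<subseteq> span D" "card D = dim V\<^sub>0"
    using basis_exists by blast
  \<comment> \<open>For d in \<open>V\<^sub>0\<close>, \<open>wedge d\<close> sends c to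
    \<open>b c c *s d\<close>, hence the inverse factor.\<close>
  have wc: "wedge (inverse (b c c) *s d) c = d" if "d \<in> V\<^sub>0" for d
    using that c(2) b_comm[of d c] by (simp add: wedge_def V0(1))
  have "has_nil_space (Alt_b scale b) V (k + card D)"
    by (rule has_nil_space_extend[OF W0 uc nilW W0W D(2), where g = "\<lambda>d. wedge (inverse (b c c) *s d)"])
      (use wW wc D(1) subspace_scale[OF sV0] in auto)
  then show ?thesis using D(4) by simp
qed

lemma orth_left: "\<lbrakk>z \<in> orth b H; h \<in> H\<rbrakk> \<Longrightarrow> b z h = 0"
  by (simp add: orth_def b_comm[of z h])

text \<open>While \<open>F\<close> contains a nonzero vector of the radical of N, the isotropic part
  of \<open>V\<close>, reduce by that vector. Otherwise N is a nondegenerate hyperplane orthogonal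
  to an anisotropic \<open>c\<close>, and \<open>lower_Alt_symplectic_sum\<close> applies; this
  includes F = 0.\<close>

lemma lower_Alt_odd:
  assumes "nondeg_on V" "max_singular V F" "dim V = 2 * dim F + 1"
  shows "\<exists>k. has_nil_space (Alt_b scale b) V k \<and> dim F * dim F + dim (V \<inter> KerQ b) \<le> k + dim F"
  using assms
proof (induction "dim F" arbitrary: V F rule: less_induct)
  case less
  note V = less.prems(1) and F = less.prems(2) and n = less.prems(3)
  have sV: "subspace V" using V by (simp add: nondeg_on_def)
  have sF: "subspace F" and FV: "F \<subseteq> V" and max: "V \<inter> KerQ b \<inter> orth b F \<subseteq> F"
    using F by (auto simp: max_singular_def)
  define N where "N = V \<inter> KerQ b"
  have sN: "subspace N" unfolding N_def by (rule subspace_inter[OF sV subspace_KerQ])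
  have NV: "N \<subseteq> V" by (simp add: N_def)
  have FN: "F \<subseteq> N" unfolding N_def using max_singular_isotropic[OF F] by (auto simp: KerQ_def)
  show ?case
  proof (cases "\<exists>x\<in>F. x \<noteq> 0 \<and> (\<forall>z\<in>N. b x z = 0)")
    case True
    then obtain x where xF: "x \<in> F" "x \<noteq> 0" and xN: "\<And>z. z \<in> V \<inter> KerQ b \<Longrightarrow> b x z = 0"
      unfolding N_def by blast
    then obtain y0 where "isotropic_pair scale Basis b V x y0"
      using isotropic_pair_exists[OF V] max_singular_isotropic[OF F xF(1)] by blast
    then interpret isotropic_pair scale Basis b V x y0 .
    note F1 = max_singular_V1[OF F xF(1)]
    define f where "f = dim (F \<inter> V\<^sub>1)"
    have f: "dim F = f + 1" using F1(2) by (simp add: f_def)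
    have d: "dim V\<^sub>1 = 2 * dim (F \<inter> V\<^sub>1) + 1" using dim_V1 n F1(2) by simp
    have "dim (F \<inter> V\<^sub>1) < dim F" using F1(2) by simp
    from less.hyps[OF this nondeg_V1 F1(1) d] obtain k where
      k: "has_nil_space (Alt_b scale b) V\<^sub>1 k" "f * f + dim (V\<^sub>1 \<inter> KerQ b) \<le> k + f"
      unfolding f_def by blast
    have "has_nil_space (Alt_b scale b) V (k + dim V\<^sub>1)"
      by (rule has_nil_space_step(1)[OF _ k(1)]) simp
    moreover have "dim F * dim F + dim (V \<inter> KerQ b) \<le> (k + dim V\<^sub>1) + dim F"
      using k(2) dim_KerQ_V1_radical[OF xN] d unfolding f f_def[symmetric] by simp
    ultimately show ?thesis by blast
  next
    case False
    define P where "P = V \<inter> orth b F"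
    define R where "R = V \<inter> orth b N"
    have sP: "subspace P" and sR: "subspace R"
      unfolding P_def R_def by (rule subspace_inter[OF sV subspace_orth])+
    have dP: "dim P + dim F = dim V" unfolding P_def by (rule dim_orth[OF V sF FV])
    have dR: "dim R + dim N = dim V" unfolding R_def by (rule dim_orth[OF V sN NV])
    have RP: "R \<subseteq> P" using FN by (auto simp: R_def P_def orth_def)
    have FP: "F \<subseteq> P" using FV F by (auto simp: P_def orth_def max_singular_def totally_singular_def)
    have RF: "z = 0" if "z \<in> R" "z \<in> F" for z
    proof -
      have "\<forall>w\<in>N. b z w = 0" using that(1) orth_left unfolding R_def by blast
      then show ?thesis using False that(2) by blast
    qed
    then have "R \<inter> F \<subseteq> {0}" by auto
    then have "dim (R \<inter> F) = 0" by (simp only: dim_eq_0)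
    \<comment> \<open>\<open>R\<close> and \<open>F\<close> meet trivially inside \<open>P\<close>,
      of dimension dim F + 1.\<close>
    then have dR1: "dim R \<le> 1" using dim_add_le[OF sR sF sP RP FP] dP n by linarith
    \<comment> \<open>If Q vanished on \<open>V\<close>, maximality would give P = F.\<close>
    have "N \<noteq> V"
    proof
      assume "N = V"
      then have "P \<subseteq> F" using max by (auto simp: P_def N_def)
      then show False using dim_subset[of P F] dP n by simp
    qed
    then have "dim N \<noteq> dim V" using subspace_dim_equal[OF sN sV NV] by auto
    then have dN: "dim N = 2 * dim F" using dR dR1 n by simp
    then have "Suc 0 = dim R" using dR n by simp
    then obtain c where c: "c \<in> R" "c \<noteq> 0" using exists_nonzero by blast
    have cV: "c \<in> V" using c(1) by (simp add: R_def)
    have cc: "b c c \<noteq> 0"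
    proof
      assume "b c c = 0"
      then have "c \<in> F" using max c(1) RP cV by (auto simp: P_def KerQ_def)
      then show False using RF c by blast
    qed
    define V\<^sub>0 where "V\<^sub>0 = {z \<in> V. b c z = 0}"
    have sV0: "subspace V\<^sub>0" unfolding V\<^sub>0_def by (rule subspace_kernel_functional[OF sV linear_b])
    have V0V: "V\<^sub>0 \<subseteq> V" by (auto simp: V\<^sub>0_def)
    have NV0: "N \<subseteq> V\<^sub>0" using NV c(1) orth_left unfolding V\<^sub>0_def R_def by blast
    have "c \<notin> V\<^sub>0" using cc by (simp add: V\<^sub>0_def)
    then have "V\<^sub>0 \<noteq> V" using cV by blast
    then have "dim V\<^sub>0 < dim V" using subspace_dim_equal[OF sV0 sV V0V] by (cases "dim V\<^sub>0 < dim V") auto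
    \<comment> \<open>A proper subspace of \<open>V\<close> containing N has dimension at most 2 dim
      F, which is the dimension of N.\<close>
    then have N: "N = V\<^sub>0" using subspace_dim_equal[OF sN sV0 NV0] dN n by simp
    have dV0: "dim V\<^sub>0 = 2 * dim F + 0" using dN N by simp
    have ndV0: "nondeg_on V\<^sub>0"
      unfolding nondeg_on_def
    proof (intro conjI sV0 ballI impI)
      fix z assume z: "z \<in> V\<^sub>0" "\<forall>y\<in>V\<^sub>0. b z y = 0"
      have zc: "b z c = 0" using z(1) b_comm[of z c] by (simp add: V\<^sub>0_def)
      have "b z y = 0" if "y \<in> V" for y
      proof -
        have "y - (b c y / b c c) *s c \<in> V\<^sub>0"
          unfolding V\<^sub>0_def using that cV cc by (simp add: subspace_diff[OF sV] subspace_scale[OF sV])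
        then have "b z (y - (b c y / b c c) *s c) = 0" using z(2) by blast
        then show ?thesis using zc by simp
      qed
      then show "z = 0" using V z(1) V0V unfolding nondeg_on_def by blast
    qed
    have "max_singular V\<^sub>0 F"
      using F FN V0V unfolding N max_singular_def by blast
    then have "has_nil_space (Alt_b scale b) V\<^sub>0 (dim F * (dim F + 0 - 1))"
      using ndV0 dV0 by (intro lower_Alt)
    then have "has_nil_space (Alt_b scale b) V (dim F * (dim F + 0 - 1) + dim V\<^sub>0)"
      using NV0 N by (intro lower_Alt_symplectic_sum[OF sV cV cc V\<^sub>0_def]) (auto simp: N_def)
    moreover have "dim F * dim F + dim (V \<inter> KerQ b) \<le> (dim F * (dim F + 0 - 1) + dim V\<^sub>0) + dim F"
      unfolding N_def[symmetric] dN dV0 by (cases "dim F") (simp_all add: algebra_simps)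
    ultimately show ?thesis by blast
  qed
qed

section \<open>The Witt index, SKer Q and the conclusion\<close>

lemma witt_index_witness:
  obtains F where "max_singular UNIV F" "dim F = witt_index scale b"
proof -
  define T where "T = {dim X |X. subspace X \<and> totally_singular b X}"
  have "T \<subseteq> {.. dim (UNIV :: 'v set)}" unfolding T_def using dim_subset[OF subset_UNIV] by auto
  then have fin: "finite T" by (rule finite_subset) simp
  have w: "witt_index scale b = Max T" by (simp add: witt_index_def T_def)
  have "totally_singular b {0}" by (simp add: totally_singular_def)
  then have "T \<noteq> {}" unfolding T_def using subspace_single_0 by blast
  then have "Max T \<in> T" using fin by (rule Max_in[rotated])
  then obtain F where F: "subspace F" "totally_singular b F" "dim F = Max T" unfolding T_def by force
  \<comment> \<open>Otherwise the span of z and \<open>F\<close> would be totally singular of larger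
    dimension.\<close>
  have "z \<in> F" if z: "b z z = 0" "\<And>f. f \<in> F \<Longrightarrow> b f z = 0" for z
  proof (rule ccontr)
    assume "z \<notin> F"
    then have "z \<notin> span F" using F(1) by (simp add: span_eq_iff[THEN iffD2])
    then have d: "dim (span (insert z F)) = dim F + 1" by (simp add: dim_insert)
    have 1: "b h g = 0" if "h \<in> insert z F" "g \<in> insert z F" for h g
      using that F(2) z b_comm[of z g] unfolding totally_singular_def by auto
    have 2: "b h g = 0" if h: "h \<in> span (insert z F)" and g: "g \<in> insert z F" for h g
      by (rule orth_span[OF 1[OF _ g] h])
    have "b h g = 0" if h: "h \<in> span (insert z F)" and g: "g \<in> span (insert z F)" for h g
    proof -
      have "b f h = 0" if "f \<in> insert z F" for f using 2[OF h that] b_comm[of f h] by simp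
      from orth_span[OF this g] show ?thesis using b_comm[of h g] by simp
    qed
    then have "totally_singular b (span (insert z F))" by (simp add: totally_singular_def)
    then have "dim (span (insert z F)) \<in> T" unfolding T_def using subspace_span by blast
    then show False using Max_ge[OF fin] d F(3) by fastforce
  qed
  then have "max_singular UNIV F"
    using F(1,2) by (auto simp: max_singular_def KerQ_def orth_def)
  then show thesis using that F(3) w by simp
qed

lemma nondeg_on_UNIV: "nondeg_on UNIV"
  using nd by (simp add: nondeg_on_def nondegenerate_def)

lemma nil_space_UNIV: "nil_space S UNIV W \<longleftrightarrow> nilpotent_subspace_of scale S W"
  unfolding nil_space_def nilpotent_subspace_of_def by blast

lemma greatest_nilpotent_dimI:
  assumes upper: "\<And>W. nil_space S UNIV W \<Longrightarrow> \<exists>C. finite C \<and> card C \<le> d \<and> W \<subseteq> E.span C"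
    and lower: "has_nil_space S UNIV k" "d \<le> k"
  shows "greatest_nilpotent_dim scale S d"
  unfolding greatest_nilpotent_dim_def
proof (intro conjI allI impI)
  obtain W B where W: "nil_space S UNIV W" "B \<subseteq> W" "E.independent B" "k \<le> card B"
    using lower(1) unfolding has_nil_space_def by blast
  obtain C where C: "finite C" "card C \<le> d" "W \<subseteq> E.span C" using upper[OF W(1)] by blast
  have "d \<le> card B" using W(4) lower(2) by linarith
  then have "E.dim W = d" by (rule E.dim_eq_independent_card[OF C(3,1,2) W(2,3)])
  then show "\<exists>W. nilpotent_subspace_of scale S W \<and> E.dim W = d"
    using W(1)[unfolded nil_space_UNIV] by (intro exI conjI)
next
  fix W assume "nilpotent_subspace_of scale S W"
  then obtain C where "finite C" "card C \<le> d" "W \<subseteq> E.span C"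
    using upper[unfolded nil_space_UNIV, of W] by blast
  then show "E.dim W \<le> d" using E.dim_le_card[of W C] by linarith
qed

text \<open>With P the orthogonal of \<open>F\<close>, SKer Q is the orthogonal of P + Ker Q, and P
  meets Ker Q exactly in \<open>F\<close>; the dimension formulas for sums and orthogonals give the
  equality.\<close>

lemma dim_SKerQ:
  assumes F: "max_singular UNIV F"
  shows "dim (SKerQ b) + dim (KerQ b) = 2 * dim F"
proof -
  have sF: "subspace F" using F by (simp add: max_singular_def)
  define P where "P = UNIV \<inter> orth b F"
  define R where "R = UNIV \<inter> orth b (KerQ b)"
  have sP: "subspace P" and sR: "subspace R"
    unfolding P_def R_def by (rule subspace_inter[OF subspace_UNIV subspace_orth])+
  have dP: "dim P + dim F = dim (UNIV :: 'v set)"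
    unfolding P_def by (rule dim_orth[OF nondeg_on_UNIV sF subset_UNIV])
  define A where "A = {p + q |p q. p \<in> P \<and> q \<in> KerQ b}"
  have sA: "subspace A" unfolding A_def by (rule subspace_sums[OF sP subspace_KerQ])
  have FK: "F \<subseteq> KerQ b" using max_singular_isotropic[OF F] by (auto simp: KerQ_def)
  have "F \<subseteq> P"
    using F unfolding P_def orth_def max_singular_def totally_singular_def by blast
  moreover have "P \<inter> KerQ b \<subseteq> F" using F unfolding max_singular_def P_def by blast
  ultimately have PK: "P \<inter> KerQ b = F" using FK by blast
  then have dA: "dim A + dim F = dim P + dim (KerQ b)"
    unfolding A_def using dim_sums_Int[OF sP subspace_KerQ] by simp
  have "SKerQ b = UNIV \<inter> orth b A"
  proof (intro equalityI subsetI)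
    fix z assume z: "z \<in> SKerQ b"
    then have zK: "z \<in> KerQ b" "\<And>q. q \<in> KerQ b \<Longrightarrow> b q z = 0" by (simp_all add: SKerQ_def orth_def)
    then have "z \<in> P" using FK unfolding P_def orth_def by blast
    then have "z \<in> F" using PK zK(1) by blast
    then have "b p z = 0" if "p \<in> P" for p using that orth_left[of p F z] by (simp add: P_def)
    then have "b a z = 0" if "a \<in> A" for a using that zK(2) unfolding A_def by fastforce
    then show "z \<in> UNIV \<inter> orth b A" by (simp add: orth_def)
  next
    fix z assume z: "z \<in> UNIV \<inter> orth b A"
    have sub: "P \<subseteq> A" "KerQ b \<subseteq> A"
      unfolding A_def using subspace_0[OF subspace_KerQ] subspace_0[OF sP] by force+
    have zA: "b h z = 0" if "h \<in> A" for h using z that by (simp add: orth_def)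
    then have zK: "z \<in> orth b (KerQ b)" using sub(2) unfolding orth_def by blast
    then have "z \<in> P" using FK unfolding P_def orth_def by blast
    then have "z \<in> A" using sub by blast
    then have "b z z = 0" by (rule zA)
    then show "z \<in> SKerQ b" using zK by (simp add: SKerQ_def KerQ_def)
  qed
  then have "dim (SKerQ b) + dim A = dim (UNIV :: 'v set)"
    using dim_orth[OF nondeg_on_UNIV sA subset_UNIV] by simp
  then show ?thesis using dA dP by simp
qed

end

theorem theorem1p3:
  fixes scale :: "'a::field \<Rightarrow> 'v::ab_group_add \<Rightarrow> 'v"
    and Basis :: "'v set"
    and b :: "'v \<Rightarrow> 'v \<Rightarrow> 'a"
  assumes char2: "CHAR('a) = 2"
    and fd: "finite_dimensional_vector_space scale Basis"
    and bil: "symmetric_bilinear_form scale b"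
    and nd: "nondegenerate b"
  defines "n \<equiv> vector_space.dim scale (UNIV :: 'v set)"
    and "\<nu> \<equiv> witt_index scale b"
  shows "greatest_nilpotent_dim scale (Sym_b scale b) (\<nu> * (n - \<nu>)) \<and>
         (n \<noteq> 2 * \<nu> + 1 \<longrightarrow>
           greatest_nilpotent_dim scale (Alt_b scale b) (\<nu> * (n - \<nu> - 1))) \<and>
         (n = 2 * \<nu> + 1 \<longrightarrow>
           greatest_nilpotent_dim scale (Alt_b scale b)
             (\<nu> * (n - \<nu>) - vector_space.dim scale (SKerQ b)))"
proof -
  interpret finite_dimensional_vector_space scale Basis by (rule fd)
  interpret nondegenerate_form scale Basis b by unfold_locales (use char2 bil nd in auto)
  obtain F where F: "max_singular UNIV F" "dim F = \<nu>"
    unfolding \<nu>_def using witt_index_witness .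
  have sF: "subspace F" using F(1) by (simp add: max_singular_def)
  \<comment> \<open>Yields 2\<nu> \<le> n, so that m = n - 2\<nu> is a natural number.\<close>
  have "F \<subseteq> UNIV \<inter> orth b F"
    using F(1) by (auto simp: max_singular_def totally_singular_def orth_def)
  then have "dim F + dim F \<le> n"
    unfolding n_def using dim_subset[of F "UNIV \<inter> orth b F"] dim_orth[OF nondeg_on_UNIV sF subset_UNIV] by simp
  then obtain m where m: "n = 2 * \<nu> + m" using F(2) le_Suc_ex[of "2 * \<nu>" n] by auto
  have dV: "dim (UNIV :: 'v set) = 2 * dim F + m" using m F(2) by (simp add: n_def)
  show ?thesis
  proof (intro conjI impI)
    have "\<nu> * (n - \<nu>) = dim F * (dim F + m)" unfolding F(2) m by simp
    then show "greatest_nilpotent_dim scale (Sym_b scale b) (\<nu> * (n - \<nu>))"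
      using greatest_nilpotent_dimI[OF upper_Sym[OF nondeg_on_UNIV F(1) _ dV]
        lower_Sym[OF nondeg_on_UNIV F(1) dV] order_refl] by simp
  next
    assume "n \<noteq> 2 * \<nu> + 1"
    then have "m \<noteq> 1" using m by simp
    moreover have "\<nu> * (n - \<nu> - 1) = dim F * (dim F + m - 1)" unfolding F(2) m by simp
    ultimately show "greatest_nilpotent_dim scale (Alt_b scale b) (\<nu> * (n - \<nu> - 1))"
      using greatest_nilpotent_dimI[OF upper_Alt[OF nondeg_on_UNIV F(1) _ dV]
        lower_Alt[OF nondeg_on_UNIV F(1) dV] order_refl] by simp
  next
    assume "n = 2 * \<nu> + 1"
    then have d1: "dim (UNIV :: 'v set) = 2 * dim F + 1" and n\<nu>: "n - \<nu> = \<nu> + 1" using dV m by simp_all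
    obtain k where k: "has_nil_space (Alt_b scale b) UNIV k" "\<nu> * \<nu> + dim (KerQ b) \<le> k + \<nu>"
      using lower_Alt_odd[OF nondeg_on_UNIV F(1) d1] F(2) by auto
    have SK: "dim (SKerQ b) + dim (KerQ b) = 2 * \<nu>" using dim_SKerQ[OF F(1)] F(2) by simp
    have "F \<subseteq> KerQ b" using max_singular_isotropic[OF F(1)] by (auto simp: KerQ_def)
    then have "\<nu> \<le> dim (KerQ b)" using dim_subset F(2) by metis
    \<comment> \<open>From \<nu> \<le> dim (Ker Q) follows dim (SKer Q) \<le> \<nu>, so the
      subtraction in the natural numbers does not truncate.\<close>
    then have eq: "\<nu> * (n - \<nu>) - dim (SKerQ b) + \<nu> = \<nu> * \<nu> + dim (KerQ b)"
      unfolding n\<nu> using SK by simp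
    show "greatest_nilpotent_dim scale (Alt_b scale b) (\<nu> * (n - \<nu>) - dim (SKerQ b))"
    proof (rule greatest_nilpotent_dimI[OF _ k(1)])
      fix W assume "nil_space (Alt_b scale b) UNIV W"
      then obtain C where "finite C" "card C + \<nu> \<le> \<nu> * \<nu> + dim (KerQ b)" "W \<subseteq> E.span C"
        using upper_Alt_odd[OF nondeg_on_UNIV F(1) _ d1] F(2) by auto
      then show "\<exists>C. finite C \<and> card C \<le> \<nu> * (n - \<nu>) - dim (SKerQ b) \<and> W \<subseteq> E.span C"
        using eq by (intro exI[of _ C]) simp
    qed (use k(2) eq in simp)
  qed
qed

end
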